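(* For the submodule $M=[z-w]$ of $H^2(\mathbb{D}^2)$ and any $(a,b)\in\mathbb{D}^2$, we have $$\Sigma_1^{M}(a,b)\le 2.$$
   Context: $\mathbb{D}$ is the open unit disk and $H^2(\mathbb{D}^2)$ the Hardy space over the bidisk. A submodule is a closed subspace of $H^2(\mathbb{D}^2)$ invariant under multiplication by $z$ and $w$. $[h]$ is the submodule generated by $h$, i.e. the norm closure of $\mathbb{C}[z,w]\cdot h$. For a submodule $M$ and bounded analytic $\phi$ with $\phi M\subseteq M$, $R_\phi$ denotes multiplication by $\phi$ on $M$; $[A,B]=AB-BA$. For $a\in\mathbb{D}$ let $\varphi_a(\zeta)=\frac{a-\zeta}{1-\bar a\zeta}$. For $(a,b)\in\mathbb{D}^2$ let $P_a',Q_b'$ be the orthogonal projections from $M$ onto $(z-a)(M\ominus(w-b)M)$ and $(w-b)(M\ominus(z-a)M)$, respectively. The numerical invariant function $\Sigma_1^M$ is $$\Sigma_1^M(a,b)=\|P_a'Q_b'\|_{H.S.}^2=\|[R_{\varphi_a(z)}^*,R_{\varphi_b(w)}]\|_{H.S.}^2,$$ where $\|\cdot\|_{H.S.}$ is the Hilbert-Schmidt norm. (The submodule $[z-w]$ is Hilbert-Schmidt, meaning that $[R_z^*,R_z][R_w^*,R_w]$ and $[R_z^*,R_w]$ are Hilbert-Schmidt operators, so that this quantity is finite.) *)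

theory Defs
  imports "HOL-Analysis.Analysis"
begin

definition bidisk :: "(complex \<times> complex) set" where
  "bidisk = ball 0 1 \<times> ball 0 1"

text \<open>Functions on the bidisk are represented by total functions vanishing outside of it, so
  that equality of functions is equality on the bidisk.\<close>

definition on_bidisk :: "(complex \<times> complex \<Rightarrow> complex) \<Rightarrow> complex \<times> complex \<Rightarrow> complex" where
  "on_bidisk f = (\<lambda>p. if p \<in> bidisk then f p else 0)"

definition has_taylor ::
    "(complex \<times> complex \<Rightarrow> complex) \<Rightarrow> (nat \<times> nat \<Rightarrow> complex) \<Rightarrow> bool" where
  "has_taylor f c \<longleftrightarrow>
     (\<forall>(z, w)\<in>bidisk. ((\<lambda>(i, j). c (i, j) * z ^ i * w ^ j) has_sum f (z, w)) UNIV)"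

definition H2 :: "(complex \<times> complex \<Rightarrow> complex) set" where
  "H2 = {f. (\<forall>p. p \<notin> bidisk \<longrightarrow> f p = 0) \<and>
            (\<exists>c. has_taylor f c \<and> (\<lambda>n. (cmod (c n))\<^sup>2) summable_on UNIV)}"

definition taylor_coeff :: "(complex \<times> complex \<Rightarrow> complex) \<Rightarrow> nat \<times> nat \<Rightarrow> complex" where
  "taylor_coeff f = (THE c. has_taylor f c)"

definition H2_inner ::
    "(complex \<times> complex \<Rightarrow> complex) \<Rightarrow> (complex \<times> complex \<Rightarrow> complex) \<Rightarrow> complex" where
  "H2_inner f g = (\<Sum>\<^sub>\<infinity>n. taylor_coeff f n * cnj (taylor_coeff g n))"

definition H2_norm :: "(complex \<times> complex \<Rightarrow> complex) \<Rightarrow> real" where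
  "H2_norm f = sqrt (\<Sum>\<^sub>\<infinity>n. (cmod (taylor_coeff f n))\<^sup>2)"

definition poly_functions :: "(complex \<times> complex \<Rightarrow> complex) set" where
  "poly_functions = {q. \<exists>(d::nat) (c :: nat \<Rightarrow> nat \<Rightarrow> complex).
     \<forall>z w. q (z, w) = (\<Sum>i\<le>d. \<Sum>j\<le>d. c i j * z ^ i * w ^ j)}"

definition generated_submodule ::
    "(complex \<times> complex \<Rightarrow> complex) \<Rightarrow> (complex \<times> complex \<Rightarrow> complex) set" where
  "generated_submodule h =
     {f \<in> H2. \<forall>\<epsilon>>0. \<exists>q\<in>poly_functions. H2_norm (\<lambda>p. f p - q p * h p) < \<epsilon>}"

definition mult_op ::
    "(complex \<times> complex \<Rightarrow> complex) \<Rightarrow>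
     (complex \<times> complex \<Rightarrow> complex) \<Rightarrow> (complex \<times> complex \<Rightarrow> complex)" where
  "mult_op \<phi> f = (\<lambda>p. \<phi> p * f p)"

text \<open>The adjoint of an operator \<open>T\<close> on the Hilbert space \<open>M\<close> (a closed subspace of \<open>H2\<close>). It is
  meaningful on \<open>M\<close> only.\<close>

definition adjoint_on ::
    "(complex \<times> complex \<Rightarrow> complex) set \<Rightarrow>
     ((complex \<times> complex \<Rightarrow> complex) \<Rightarrow> (complex \<times> complex \<Rightarrow> complex)) \<Rightarrow>
     (complex \<times> complex \<Rightarrow> complex) \<Rightarrow> (complex \<times> complex \<Rightarrow> complex)" where
  "adjoint_on M T g = (THE h. h \<in> M \<and> (\<forall>f\<in>M. H2_inner (T f) g = H2_inner f h))"

definition commutator ::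
    "((complex \<times> complex \<Rightarrow> complex) \<Rightarrow> (complex \<times> complex \<Rightarrow> complex)) \<Rightarrow>
     ((complex \<times> complex \<Rightarrow> complex) \<Rightarrow> (complex \<times> complex \<Rightarrow> complex)) \<Rightarrow>
     (complex \<times> complex \<Rightarrow> complex) \<Rightarrow> (complex \<times> complex \<Rightarrow> complex)" where
  "commutator A B f = (\<lambda>p. A (B f) p - B (A f) p)"

definition orthonormal_basis ::
    "(complex \<times> complex \<Rightarrow> complex) set \<Rightarrow> (complex \<times> complex \<Rightarrow> complex) set \<Rightarrow> bool" where
  "orthonormal_basis M B \<longleftrightarrow>
     B \<subseteq> M \<and>
     (\<forall>e\<in>B. \<forall>f\<in>B. H2_inner e f = (if e = f then 1 else 0)) \<and>
     (\<forall>f\<in>M. (\<forall>e\<in>B. H2_inner f e = 0) \<longrightarrow> f = (\<lambda>_. 0))"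

text \<open>The squared Hilbert-Schmidt norm of an operator on \<open>M\<close>; for a bounded operator the sum does
  not depend on the orthonormal basis. It takes values in \<^typ>\<open>ennreal\<close>, so a divergent sum is
  \<open>\<infinity>\<close>, and an upper bound includes the assertion that the operator is Hilbert-Schmidt.\<close>

definition HS_norm_sq ::
    "(complex \<times> complex \<Rightarrow> complex) set \<Rightarrow>
     ((complex \<times> complex \<Rightarrow> complex) \<Rightarrow> (complex \<times> complex \<Rightarrow> complex)) \<Rightarrow> ennreal" where
  "HS_norm_sq M T =
     (let B = (SOME B. orthonormal_basis M B) in \<Sum>\<^sub>\<infinity>e\<in>B. ennreal ((H2_norm (T e))\<^sup>2))"

definition blaschke :: "complex \<Rightarrow> complex \<Rightarrow> complex" where
  "blaschke a \<zeta> = (a - \<zeta>) / (1 - cnj a * \<zeta>)"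

text \<open>The invariant is defined by the commutator. It equals the squared Hilbert-Schmidt norm of
  \<open>P Q\<close>, where \<open>P\<close> and \<open>Q\<close> are the orthogonal projections of \<open>M\<close> onto
  \<open>\<phi>\<^sub>a(z) (M \<ominus> (w - b) M)\<close> and \<open>\<phi>\<^sub>b(w) (M \<ominus> (z - a) M)\<close>. For \<open>(a, b) \<noteq> (0, 0)\<close> the factors
  \<open>\<phi>\<^sub>a(z)\<close> and \<open>\<phi>\<^sub>b(w)\<close> cannot in general be replaced by \<open>z - a\<close> and \<open>w - b\<close> here, because
  \<open>M \<ominus> (w - b) M\<close> need not be invariant under multiplication by \<open>z\<close>.\<close>

definition Sigma1 ::
    "(complex \<times> complex \<Rightarrow> complex) set \<Rightarrow> complex \<Rightarrow> complex \<Rightarrow> ennreal" where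
  "Sigma1 M a b =
     HS_norm_sq M (commutator (adjoint_on M (mult_op (\<lambda>(z, w). blaschke a z)))
                              (mult_op (\<lambda>(z, w). blaschke b w)))"

end

theory Submission
  imports Defs
begin

text \<open>
  Write \<open>M\<close> for the submodule \<open>[z - w]\<close>, \<open>N\<close> for its orthogonal complement in the Hardy space, and \<open>P\<close>
  for the projection onto \<open>M\<close>. The submodule consists of the functions that vanish on the diagonal
  (\<open>generated_submodule_eq\<close>), so \<open>N\<close> has the orthonormal basis \<open>e n\<close> of normalized sums of all monomials
  of degree \<open>n\<close>.

  Let \<open>A\<close> and \<open>B\<close> be the operators from \<open>N\<close> to \<open>M\<close> that multiply by \<open>\<phi>\<^sub>b(w)\<close> and by \<open>\<phi>\<^sub>a(z)\<close> and then
  apply \<open>P\<close>. On the whole Hardy space, multiplication by \<open>\<phi>\<^sub>b(w)\<close> commutes with the adjoint of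
  multiplication by \<open>\<phi>\<^sub>a(z)\<close>, so the commutator on \<open>M\<close> arises only from the passage through \<open>N\<close>: it is
  the product of \<open>A\<close> with the adjoint of \<open>B\<close> (\<open>blaschke_commutator_eq\<close>).

  The singular values of \<open>A\<close> and \<open>B\<close> are known. For \<open>a = 0\<close>, a computation with coefficients shows that
  \<open>P\<close> maps the functions \<open>z * e n\<close> to pairwise orthogonal functions of squared norm \<open>1 / (n + 2)\<close>
  (\<open>submodule_part_mult_z_sums\<close>). For general \<open>a\<close>, the operator \<open>U a\<close> that composes with
  \<open>\<phi>\<^sub>a\<close> in both variables and multiplies by normalized Szego kernels is a unitary involution of the
  Hardy space. It preserves the diagonal, hence \<open>M\<close> and \<open>N\<close>, and it intertwines multiplication by \<open>z\<close>
  with multiplication by \<open>\<phi>\<^sub>a(z)\<close>. So \<open>B\<close> has the same singular values, attained at the functions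
  \<open>U a (e n)\<close>, and likewise \<open>A\<close> at the functions \<open>U b (e m)\<close>. Consequently the squared Hilbert-Schmidt
  norm is bounded by
  \<open>\<Sum>m n. \<bar>\<langle>U b (e m), U a (e n)\<rangle>\<bar>\<^sup>2 / ((m + 2) (n + 2)) \<le> \<Sum>n. 1 / (n + 2)\<^sup>2 \<le> 1\<close>
  (\<open>blaschke_commutator_sum_le\<close>): the squared inner products have row and column sums at most 1, and
  \<open>2 x y \<le> x\<^sup>2 + y\<^sup>2\<close>.

  That \<open>U a\<close> maps the Hardy space into itself is proved one variable at a time
  (\<open>moebius_z_has_taylor\<close>): the coefficients of the image of \<open>f\<close> are the inner products of \<open>f\<close> with the
  orthonormal images of the monomials, and Bessel's inequality makes them square-summable.
\<close>

section \<open>Uniqueness of Taylor coefficients\<close>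

text \<open>An unconditional sum over pairs may be evaluated along the triangles \<open>i + j < K\<close>. This groups
  a double power series by total degree, and the submodule below is described degree by degree.\<close>

lemma filterlim_triangles:
  "filterlim (\<lambda>K. {(i, j). i + j < K} :: (nat \<times> nat) set) (finite_subsets_at_top UNIV) sequentially"
proof (rule filterlim_finite_subsets_at_top[THEN iffD2], intro allI impI)
  fix X :: "(nat \<times> nat) set"
  assume "finite X \<and> X \<subseteq> UNIV"
  then have fin: "finite ((\<lambda>(i, j). i + j) ` X)" by auto
  obtain B where B: "\<And>x. x \<in> (\<lambda>(i, j). i + j) ` X \<Longrightarrow> x < B"
    using finite_nat_set_iff_bounded fin by auto
  have fin_tri: "finite {(i, j). i + j < (K :: nat)}" for K
    by (rule finite_subset[of _ "{..K} \<times> {..K}"]) auto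
  show "\<forall>\<^sub>F K in sequentially. finite {(i, j). i + j < K} \<and> X \<subseteq> {(i, j). i + j < K} \<and> {(i, j). i + j < K} \<subseteq> UNIV"
    by (rule eventually_sequentiallyI[of B]) (use fin_tri B in fastforce)
qed

lemma antidiagonal_sums:
  fixes f :: "nat \<times> nat \<Rightarrow> 'a :: real_normed_vector"
  assumes "(f has_sum s) UNIV"
  shows "(\<lambda>n. \<Sum>i\<le>n. f (i, n - i)) sums s"
proof -
  have "(\<lambda>K. sum f {(i, j). i + j < K}) \<longlonglongrightarrow> s"
    using filterlim_compose[OF assms[unfolded has_sum_def] filterlim_triangles] .
  moreover have "sum f {(i, j). i + j < K} = (\<Sum>n<K. \<Sum>i\<le>n. f (i, n - i))" for K
    using sum.triangle_reindex[of "\<lambda>i j. f (i, j)" K] by (simp add: case_prod_unfold)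
  ultimately show ?thesis by (simp add: sums_def)
qed

lemma power_series_coeffs_zero:
  fixes a :: "nat \<Rightarrow> complex"
  assumes "\<And>t. cmod t < 1 \<Longrightarrow> (\<lambda>n. a n * t ^ n) sums 0"
  shows "a n = 0"
proof -
  define F where "F = Abs_fps a"
  have ge: "fps_conv_radius F \<ge> 1 / 2"
    unfolding fps_conv_radius_def
  proof (rule conv_radius_geI_ex)
    fix r :: real assume "0 < r" "ereal r < 1 / 2"
    then have "r < 1"
      by (cases "r < 1") (auto simp: one_ereal_def numeral_eq_ereal)
    then have "(\<lambda>n. a n * complex_of_real r ^ n) sums 0"
      using \<open>0 < r\<close> by (intro assms) auto
    then show "\<exists>z. norm z = r \<and> summable (\<lambda>n. fps_nth F n * z ^ n)"
      using \<open>0 < r\<close> by (intro exI[of _ "complex_of_real r"]) (auto simp: F_def sums_iff)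
  qed
  then have pos: "fps_conv_radius F > 0"
    by (rule less_le_trans[rotated]) (auto simp: one_ereal_def numeral_eq_ereal)
  have "\<forall>\<^sub>F z in nhds 0. z \<in> ball (0 :: complex) 1"
    by (intro eventually_nhds_in_open) auto
  then have "\<forall>\<^sub>F z in nhds 0. eval_fps F z = eval_fps 0 z"
    by eventually_elim (use assms in \<open>auto simp: eval_fps_def F_def sums_iff\<close>)
  then have "F = 0"
    using pos by (intro eval_fps_eqD) auto
  then show ?thesis by (metis F_def fps_nth_Abs_fps fps_zero_nth)
qed

lemma cmod_mult_less_one: "cmod s < 1 \<Longrightarrow> cmod t < 1 \<Longrightarrow> cmod (s * t) < 1"
  using mult_strict_mono'[of "cmod s" 1 "cmod t" 1] by (simp add: norm_mult)

text \<open>On a complex line \<open>t \<mapsto> (t z, t w)\<close> the double series is a power series in \<open>t\<close> whose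
  coefficients are the homogeneous parts at \<open>(z, w)\<close>, so every homogeneous part vanishes on the
  bidisk; for fixed \<open>w\<close> it is a polynomial in \<open>z\<close>.\<close>

lemma has_taylor_zero_imp_zero:
  assumes "has_taylor (\<lambda>_. 0) c"
  shows "c (i, j) = 0"
proof -
  have homogeneous: "(\<Sum>i\<le>n. c (i, n - i) * z ^ i * w ^ (n - i)) = 0"
    if "cmod z < 1" "cmod w < 1" for z w n
  proof (rule power_series_coeffs_zero)
    fix t :: complex assume t: "cmod t < 1"
    have "cmod (t * z) < 1" "cmod (t * w) < 1"
      using that t by (auto simp: intro!: cmod_mult_less_one)
    then have "((\<lambda>(i, j). c (i, j) * (t * z) ^ i * (t * w) ^ j) has_sum 0) UNIV"
      using assms by (auto simp: has_taylor_def bidisk_def)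
    from antidiagonal_sums[OF this]
    have "(\<lambda>n. \<Sum>i\<le>n. c (i, n - i) * (t * z) ^ i * (t * w) ^ (n - i)) sums 0" by simp
    moreover have "(\<Sum>i\<le>n. c (i, n - i) * (t * z) ^ i * (t * w) ^ (n - i))
        = (\<Sum>i\<le>n. c (i, n - i) * z ^ i * w ^ (n - i)) * t ^ n" for n
      by (subst sum_distrib_right, rule sum.cong)
        (auto simp: power_mult_distrib power_add[symmetric] mult_ac)
    ultimately show "(\<lambda>n. (\<Sum>i\<le>n. c (i, n - i) * z ^ i * w ^ (n - i)) * t ^ n) sums 0" by simp
  qed
  define n where "n = i + j"
  define b where "b k = (if k \<le> n then c (k, n - k) * (1/2) ^ (n - k) else 0)" for k
  have "b i = 0"
  proof (rule power_series_coeffs_zero)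
    fix t :: complex assume t: "cmod t < 1"
    have "(\<lambda>k. b k * t ^ k) sums (\<Sum>k\<le>n. b k * t ^ k)"
      by (rule sums_finite) (auto simp: b_def)
    also have "(\<Sum>k\<le>n. b k * t ^ k) = (\<Sum>k\<le>n. c (k, n - k) * t ^ k * (1/2) ^ (n - k))"
      by (rule sum.cong) (auto simp: b_def)
    also have "\<dots> = 0" using homogeneous[OF t, of "1/2" n] by (simp add: norm_divide)
    finally show "(\<lambda>k. b k * t ^ k) sums 0" .
  qed
  then show ?thesis by (simp add: b_def n_def)
qed

lemma taylor_coeff_eqI:
  assumes "has_taylor f c"
  shows "taylor_coeff f = c"
  unfolding taylor_coeff_def
proof (rule the_equality)
  fix d assume d: "has_taylor f d"
  have "has_taylor (\<lambda>_. 0) (\<lambda>n. d n - c n)"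
    unfolding has_taylor_def
  proof safe
    fix z w assume zw: "(z, w) \<in> bidisk"
    have "((\<lambda>x. (case x of (i, j) \<Rightarrow> d (i, j) * z ^ i * w ^ j)
        + (- (case x of (i, j) \<Rightarrow> c (i, j) * z ^ i * w ^ j))) has_sum f (z, w) + (- f (z, w))) UNIV"
      using d assms zw by (intro has_sum_add has_sum_uminusI) (auto simp: has_taylor_def)
    then show "((\<lambda>(i, j). (d (i, j) - c (i, j)) * z ^ i * w ^ j) has_sum 0) UNIV"
      by (simp add: case_prod_unfold algebra_simps)
  qed
  from has_taylor_zero_imp_zero[OF this] show "d = c" by auto
qed (rule assms)

section \<open>Square-summable families\<close>

definition l2 :: "('i \<Rightarrow> complex) \<Rightarrow> bool" where
  "l2 c \<longleftrightarrow> (\<lambda>n. (cmod (c n))\<^sup>2) summable_on UNIV"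

lemma l2_boundedI:
  assumes "\<And>F. finite F \<Longrightarrow> (\<Sum>n\<in>F. (cmod (c n))\<^sup>2) \<le> B"
  shows "l2 c" "(\<Sum>\<^sub>\<infinity>n. (cmod (c n))\<^sup>2) \<le> B"
proof -
  show *: "l2 c"
    unfolding l2_def
    by (rule nonneg_bdd_above_summable_on) (use assms in \<open>auto simp: bdd_above_def\<close>)
  show "(\<Sum>\<^sub>\<infinity>n. (cmod (c n))\<^sup>2) \<le> B"
    by (rule infsum_le_finite_sums) (use * assms in \<open>auto simp: l2_def\<close>)
qed

lemma l2_sum_le:
  assumes "l2 c" "finite F"
  shows "(\<Sum>n\<in>F. (cmod (c n))\<^sup>2) \<le> (\<Sum>\<^sub>\<infinity>n. (cmod (c n))\<^sup>2)"
  using assms by (intro finite_sum_le_infsum) (auto simp: l2_def)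

lemma l2_dominated:
  assumes "l2 c" "\<And>n. cmod (d n) \<le> B * cmod (c n)"
  shows "l2 d"
  unfolding l2_def
proof (rule summable_on_comparison_test)
  show "(\<lambda>n. B\<^sup>2 * (cmod (c n))\<^sup>2) summable_on UNIV"
    using assms(1) by (auto simp: l2_def intro: summable_on_cmult_right)
  show "(cmod (d n))\<^sup>2 \<le> B\<^sup>2 * (cmod (c n))\<^sup>2" for n
    using power_mono[OF assms(2), of n 2] by (simp add: power_mult_distrib)
qed auto

lemma l2_mult_abs_summable:
  assumes "l2 c" "l2 d"
  shows "(\<lambda>n. norm (c n * d n)) summable_on UNIV"
proof (rule Infinite_Sum.abs_summable_on_comparison_test')
  show "(\<lambda>n. (cmod (c n))\<^sup>2 + (cmod (d n))\<^sup>2) summable_on UNIV"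
    using assms by (auto simp: l2_def intro: summable_on_add)
  show "norm (c n * d n) \<le> (cmod (c n))\<^sup>2 + (cmod (d n))\<^sup>2" for n
  proof -
    have "2 * cmod (c n) * cmod (d n) \<le> (cmod (c n))\<^sup>2 + (cmod (d n))\<^sup>2"
      by (rule sum_squares_bound)
    moreover have "0 \<le> cmod (c n) * cmod (d n)" by simp
    ultimately show ?thesis unfolding norm_mult by linarith
  qed
qed

lemma l2_mult_summable:
  assumes "l2 c" "l2 d"
  shows "(\<lambda>n. c n * d n) summable_on UNIV"
  using l2_mult_abs_summable[OF assms] by (rule abs_summable_summable)

lemma l2_cnj [simp]: "l2 (\<lambda>n. cnj (c n)) \<longleftrightarrow> l2 c"
  by (simp add: l2_def)

lemma l2_add:
  assumes "l2 c" "l2 d"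
  shows "l2 (\<lambda>n. c n + d n)"
  unfolding l2_def
proof (rule summable_on_comparison_test)
  show "(\<lambda>n. 2 * (cmod (c n))\<^sup>2 + 2 * (cmod (d n))\<^sup>2) summable_on UNIV"
    using assms by (auto simp: l2_def intro!: summable_on_add summable_on_cmult_right)
  show "(cmod (c n + d n))\<^sup>2 \<le> 2 * (cmod (c n))\<^sup>2 + 2 * (cmod (d n))\<^sup>2" for n
  proof -
    have "(cmod (c n + d n))\<^sup>2 \<le> (cmod (c n) + cmod (d n))\<^sup>2"
      by (intro power_mono norm_triangle_ineq) auto
    also have "\<dots> \<le> 2 * (cmod (c n))\<^sup>2 + 2 * (cmod (d n))\<^sup>2"
      using sum_squares_bound[of "cmod (c n)" "cmod (d n)"] by (simp add: power2_sum)
    finally show ?thesis .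
  qed
qed auto

lemma l2_cmult: "l2 c \<Longrightarrow> l2 (\<lambda>n. k * c n)"
  by (rule l2_dominated[where B = "cmod k"]) (auto simp: norm_mult)

lemma has_sum_bidisk_geometric:
  assumes "cmod x < 1" "cmod y < 1"
  shows "((\<lambda>(i, j). x ^ i * y ^ j) has_sum 1 / ((1 - x) * (1 - y))) UNIV"
proof -
  have geom: "((\<lambda>i. t ^ i) has_sum 1 / (1 - t)) UNIV" if "cmod t < 1" for t :: complex
    using that by (intro norm_summable_imp_has_sum geometric_sums) (auto simp: norm_power)
  have abs: "(\<lambda>i. norm (t ^ i)) summable_on UNIV" if "cmod t < 1" for t :: complex
    using that geom[of "of_real (cmod t)"]
    by (auto simp: norm_power summable_on_UNIV_nonneg_real_iff)
  have "(\<lambda>p. norm (case p of (i, j) \<Rightarrow> x ^ i * y ^ j)) summable_on UNIV \<times> UNIV"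
    using abs[OF assms(1)] abs[OF assms(2)]
    by (intro Infinite_Sum.abs_summable_on_Sigma_iff[THEN iffD2])
      (auto simp: norm_mult infsum_cmult_right' abs_mult intro!: summable_on_cmult_right summable_on_cmult_left)
  then have sm: "(\<lambda>(i, j). x ^ i * y ^ j) summable_on UNIV \<times> UNIV"
    by (rule abs_summable_summable)
  have "((\<lambda>(i, j). x ^ i * y ^ j) has_sum 1 / ((1 - x) * (1 - y))) (UNIV \<times> UNIV)"
  proof (rule has_sum_SigmaI[where g = "\<lambda>i. x ^ i * (1 / (1 - y))"])
    show "((\<lambda>j. case (i, j) of (i, j) \<Rightarrow> x ^ i * y ^ j) has_sum x ^ i * (1 / (1 - y))) UNIV" for i
      using has_sum_cmult_right[OF geom[OF assms(2)], of "x ^ i"] by simp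
    show "((\<lambda>i. x ^ i * (1 / (1 - y))) has_sum 1 / ((1 - x) * (1 - y))) UNIV"
      using has_sum_cmult_left[OF geom[OF assms(1)], of "1 / (1 - y)"] by simp
  qed (rule sm)
  then show ?thesis by simp
qed

lemma l2_geometric:
  assumes "cmod x < 1" "cmod y < 1"
  shows "l2 (\<lambda>(i, j). x ^ i * y ^ j)"
proof -
  have "((cmod x)\<^sup>2) < 1" "((cmod y)\<^sup>2) < 1"
    using assms by (auto simp: power_less_one_iff)
  then have "cmod (of_real ((cmod x)\<^sup>2)) < 1" "cmod (of_real ((cmod y)\<^sup>2)) < 1"
    by (auto simp: norm_power)
  from has_sum_imp_summable[OF has_sum_bidisk_geometric[OF this]]
  have "(\<lambda>n. complex_of_real (case n of (i, j) \<Rightarrow> ((cmod x)\<^sup>2) ^ i * ((cmod y)\<^sup>2) ^ j)) summable_on UNIV"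
    by (simp add: case_prod_unfold)
  then have "(\<lambda>n. (case n of (i, j) \<Rightarrow> ((cmod x)\<^sup>2) ^ i * ((cmod y)\<^sup>2) ^ j)) summable_on UNIV"
    by (auto dest!: summable_on_Re simp only: Re_complex_of_real)
  then show ?thesis
    unfolding l2_def
    by (simp add: case_prod_unfold norm_mult norm_power power_mult_distrib power_mult[symmetric] mult.commute)
qed

section \<open>The Hardy space of the bidisk as an inner product space\<close>

lemma H2_iff:
  "f \<in> H2 \<longleftrightarrow> (\<forall>p. p \<notin> bidisk \<longrightarrow> f p = 0) \<and> has_taylor f (taylor_coeff f) \<and> l2 (taylor_coeff f)"
  using taylor_coeff_eqI by (auto simp: H2_def l2_def)

lemma H2I:
  assumes "\<And>p. p \<notin> bidisk \<Longrightarrow> f p = 0" "has_taylor f c" "l2 c"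
  shows "f \<in> H2" "taylor_coeff f = c"
  using assms taylor_coeff_eqI[OF assms(2)] by (auto simp: H2_iff)

lemma H2_outside: "f \<in> H2 \<Longrightarrow> p \<notin> bidisk \<Longrightarrow> f p = 0"
  using H2_iff by blast

lemma H2_l2: "f \<in> H2 \<Longrightarrow> l2 (taylor_coeff f)"
  by (simp add: H2_iff)

lemma H2_has_taylor: "f \<in> H2 \<Longrightarrow> has_taylor f (taylor_coeff f)"
  by (simp add: H2_iff)

lemma H2_has_sum:
  assumes "f \<in> H2" "p \<in> bidisk"
  shows "((\<lambda>(i, j). taylor_coeff f (i, j) * fst p ^ i * snd p ^ j) has_sum f p) UNIV"
  using H2_has_taylor[OF assms(1)] assms(2) by (auto simp: has_taylor_def case_prod_unfold)

lemma H2_eqI: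
  assumes "f \<in> H2" "g \<in> H2" "taylor_coeff f = taylor_coeff g"
  shows "f = g"
proof
  fix p show "f p = g p"
  proof (cases "p \<in> bidisk")
    case True
    then show ?thesis
      using H2_has_sum[OF assms(1) True] H2_has_sum[OF assms(2) True] assms(3)
      by (auto intro: has_sum_unique)
  qed (simp add: H2_outside assms(1,2))
qed

lemma H2_add:
  assumes "f \<in> H2" "g \<in> H2"
  shows H2_add_mem [simp]: "(\<lambda>p. f p + g p) \<in> H2"
    and taylor_coeff_add [simp]: "taylor_coeff (\<lambda>p. f p + g p) = (\<lambda>n. taylor_coeff f n + taylor_coeff g n)"
proof -
  have *: "has_taylor (\<lambda>p. f p + g p) (\<lambda>n. taylor_coeff f n + taylor_coeff g n)"
    unfolding has_taylor_def
  proof safe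
    fix z w assume "(z, w) \<in> bidisk"
    from has_sum_add[OF H2_has_sum[OF assms(1) this] H2_has_sum[OF assms(2) this]]
    show "((\<lambda>(i, j). (taylor_coeff f (i, j) + taylor_coeff g (i, j)) * z ^ i * w ^ j)
        has_sum f (z, w) + g (z, w)) UNIV"
      by (simp add: case_prod_unfold algebra_simps)
  qed
  have "l2 (\<lambda>n. taylor_coeff f n + taylor_coeff g n)"
    using assms by (intro l2_add H2_l2)
  from H2I[OF _ * this] show "(\<lambda>p. f p + g p) \<in> H2"
    "taylor_coeff (\<lambda>p. f p + g p) = (\<lambda>n. taylor_coeff f n + taylor_coeff g n)"
    by (simp_all add: assms H2_outside)
qed

lemma H2_cmult:
  assumes "f \<in> H2"
  shows H2_cmult_mem [simp]: "(\<lambda>p. k * f p) \<in> H2"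
    and taylor_coeff_cmult [simp]: "taylor_coeff (\<lambda>p. k * f p) = (\<lambda>n. k * taylor_coeff f n)"
proof -
  have *: "has_taylor (\<lambda>p. k * f p) (\<lambda>n. k * taylor_coeff f n)"
    unfolding has_taylor_def
  proof safe
    fix z w assume "(z, w) \<in> bidisk"
    from has_sum_cmult_right[OF H2_has_sum[OF assms(1) this], of k]
    show "((\<lambda>(i, j). (k * taylor_coeff f (i, j)) * z ^ i * w ^ j)
        has_sum k * f (z, w)) UNIV"
      by (simp add: case_prod_unfold algebra_simps)
  qed
  have "l2 (\<lambda>n. k * taylor_coeff f n)"
    using assms by (intro l2_cmult H2_l2)
  from H2I[OF _ * this] show "(\<lambda>p. k * f p) \<in> H2"
    "taylor_coeff (\<lambda>p. k * f p) = (\<lambda>n. k * taylor_coeff f n)"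
    by (simp_all add: assms H2_outside)
qed

lemma H2_diff:
  assumes "f \<in> H2" "g \<in> H2"
  shows H2_diff_mem [simp]: "(\<lambda>p. f p - g p) \<in> H2"
    and taylor_coeff_diff [simp]: "taylor_coeff (\<lambda>p. f p - g p) = (\<lambda>n. taylor_coeff f n - taylor_coeff g n)"
proof -
  have *: "(\<lambda>p. f p - g p) = (\<lambda>p. f p + (-1) * g p)" by auto
  note neg = H2_cmult[OF assms(2), of "-1"]
  show "(\<lambda>p. f p - g p) \<in> H2"
    unfolding * by (rule H2_add_mem[OF assms(1) neg(1)])
  show "taylor_coeff (\<lambda>p. f p - g p) = (\<lambda>n. taylor_coeff f n - taylor_coeff g n)"
    unfolding * taylor_coeff_add[OF assms(1) neg(1)] neg(2) by auto
qed

lemma H2_zero [simp]: "(\<lambda>_. 0) \<in> H2" "taylor_coeff (\<lambda>_. 0) = (\<lambda>_. 0)"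
proof -
  have "has_taylor (\<lambda>_. 0) (\<lambda>_. 0)" by (simp add: has_taylor_def case_prod_unfold)
  from H2I[OF _ this] show "(\<lambda>_. 0) \<in> H2" "taylor_coeff (\<lambda>_. 0) = (\<lambda>_. 0)"
    by (auto simp: l2_def)
qed

lemma H2_sum:
  assumes "\<And>x. x \<in> F \<Longrightarrow> f x \<in> H2"
  shows H2_sum_mem: "(\<lambda>p. \<Sum>x\<in>F. f x p) \<in> H2"
    and taylor_coeff_sum: "taylor_coeff (\<lambda>p. \<Sum>x\<in>F. f x p) = (\<lambda>n. \<Sum>x\<in>F. taylor_coeff (f x) n)"
proof -
  have "(\<lambda>p. \<Sum>x\<in>F. f x p) \<in> H2 \<and> taylor_coeff (\<lambda>p. \<Sum>x\<in>F. f x p) = (\<lambda>n. \<Sum>x\<in>F. taylor_coeff (f x) n)"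
    using assms by (induction F rule: infinite_finite_induct) auto
  then show "(\<lambda>p. \<Sum>x\<in>F. f x p) \<in> H2"
    "taylor_coeff (\<lambda>p. \<Sum>x\<in>F. f x p) = (\<lambda>n. \<Sum>x\<in>F. taylor_coeff (f x) n)" by auto
qed

text \<open>The inverse of \<^const>\<open>taylor_coeff\<close>, by which operators can be defined on coefficients.\<close>

definition H2_of_coeffs :: "(nat \<times> nat \<Rightarrow> complex) \<Rightarrow> complex \<times> complex \<Rightarrow> complex" where
  "H2_of_coeffs c = on_bidisk (\<lambda>p. \<Sum>\<^sub>\<infinity>(i, j). c (i, j) * fst p ^ i * snd p ^ j)"

lemma H2_of_coeffs:
  assumes "l2 c"
  shows H2_of_coeffs_mem: "H2_of_coeffs c \<in> H2" and taylor_coeff_of_coeffs: "taylor_coeff (H2_of_coeffs c) = c"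
proof -
  have *: "has_taylor (H2_of_coeffs c) c"
    unfolding has_taylor_def
  proof safe
    fix z w assume zw: "(z, w) \<in> bidisk"
    then have "l2 (\<lambda>(i, j). z ^ i * w ^ j)" by (intro l2_geometric) (auto simp: bidisk_def)
    from has_sum_infsum[OF l2_mult_summable[OF assms this]] zw
    show "((\<lambda>(i, j). c (i, j) * z ^ i * w ^ j) has_sum H2_of_coeffs c (z, w)) UNIV"
      by (simp add: H2_of_coeffs_def on_bidisk_def case_prod_unfold algebra_simps)
  qed
  from H2I[OF _ this assms] show "H2_of_coeffs c \<in> H2" "taylor_coeff (H2_of_coeffs c) = c"
    by (auto simp: H2_of_coeffs_def on_bidisk_def)
qed

lemma H2_inner_summable:
  assumes "f \<in> H2" "g \<in> H2"
  shows "(\<lambda>n. taylor_coeff f n * cnj (taylor_coeff g n)) summable_on UNIV"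
  using assms by (intro l2_mult_summable) (auto simp: H2_l2)

lemma H2_inner_has_sum:
  assumes "f \<in> H2" "g \<in> H2"
  shows "((\<lambda>n. taylor_coeff f n * cnj (taylor_coeff g n)) has_sum H2_inner f g) UNIV"
  unfolding H2_inner_def using H2_inner_summable[OF assms] by (rule has_sum_infsum)

lemma H2_inner_eqI:
  assumes "f \<in> H2" "g \<in> H2" "((\<lambda>n. taylor_coeff f n * cnj (taylor_coeff g n)) has_sum s) UNIV"
  shows "H2_inner f g = s"
  using H2_inner_has_sum[OF assms(1,2)] assms(3) by (rule has_sum_unique)

lemma H2_inner_commute: "H2_inner f g = cnj (H2_inner g f)"
  by (simp add: H2_inner_def mult.commute flip: infsum_cnj)

lemma H2_inner_add_left [simp]:
  assumes "f \<in> H2" "g \<in> H2" "h \<in> H2"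
  shows "H2_inner (\<lambda>p. f p + g p) h = H2_inner f h + H2_inner g h"
  using assms has_sum_add[OF H2_inner_has_sum[OF assms(1,3)] H2_inner_has_sum[OF assms(2,3)]]
  by (intro H2_inner_eqI) (auto simp: algebra_simps)

lemma H2_inner_cmult_left [simp]:
  assumes "f \<in> H2" "h \<in> H2"
  shows "H2_inner (\<lambda>p. k * f p) h = k * H2_inner f h"
  using assms has_sum_cmult_right[OF H2_inner_has_sum[OF assms], of k]
  by (intro H2_inner_eqI) (auto simp: algebra_simps)

lemma H2_inner_diff_left [simp]:
  assumes "f \<in> H2" "g \<in> H2" "h \<in> H2"
  shows "H2_inner (\<lambda>p. f p - g p) h = H2_inner f h - H2_inner g h"
  using H2_inner_add_left[OF assms(1) H2_cmult_mem[OF assms(2), of "-1"] assms(3)]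
    H2_inner_cmult_left[OF assms(2,3), of "-1"] by simp

lemma H2_inner_add_right [simp]:
  assumes "f \<in> H2" "g \<in> H2" "h \<in> H2"
  shows "H2_inner h (\<lambda>p. f p + g p) = H2_inner h f + H2_inner h g"
  using assms by (subst (1 2 3) H2_inner_commute) simp

lemma H2_inner_cmult_right [simp]:
  assumes "f \<in> H2" "h \<in> H2"
  shows "H2_inner h (\<lambda>p. k * f p) = cnj k * H2_inner h f"
  using assms by (subst (1 2) H2_inner_commute) simp

lemma H2_inner_diff_right [simp]:
  assumes "f \<in> H2" "g \<in> H2" "h \<in> H2"
  shows "H2_inner h (\<lambda>p. f p - g p) = H2_inner h f - H2_inner h g"
  using assms by (subst (1 2 3) H2_inner_commute) simp

lemma H2_inner_zero [simp]: "H2_inner (\<lambda>_. 0) g = 0" "H2_inner g (\<lambda>_. 0) = 0"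
  by (simp_all add: H2_inner_def)

lemma H2_inner_sum_left:
  assumes "\<And>x. x \<in> F \<Longrightarrow> f x \<in> H2" "h \<in> H2"
  shows "H2_inner (\<lambda>p. \<Sum>x\<in>F. f x p) h = (\<Sum>x\<in>F. H2_inner (f x) h)"
  using assms by (induction F rule: infinite_finite_induct) (auto simp: H2_sum_mem)

lemma H2_inner_sum_right:
  assumes "\<And>x. x \<in> F \<Longrightarrow> f x \<in> H2" "h \<in> H2"
  shows "H2_inner h (\<lambda>p. \<Sum>x\<in>F. f x p) = (\<Sum>x\<in>F. H2_inner h (f x))"
  using assms by (induction F rule: infinite_finite_induct) (auto simp: H2_sum_mem)

lemma H2_norm_sq: "(H2_norm f)\<^sup>2 = (\<Sum>\<^sub>\<infinity>n. (cmod (taylor_coeff f n))\<^sup>2)"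
  by (simp add: H2_norm_def infsum_nonneg)

lemma H2_norm_nonneg [simp]: "H2_norm f \<ge> 0"
  by (simp add: H2_norm_def infsum_nonneg)

lemma H2_norm_has_sum:
  assumes "f \<in> H2"
  shows "((\<lambda>n. (cmod (taylor_coeff f n))\<^sup>2) has_sum (H2_norm f)\<^sup>2) UNIV"
  unfolding H2_norm_sq using H2_l2[OF assms] unfolding l2_def by (rule has_sum_infsum)

lemma H2_inner_self:
  assumes "f \<in> H2"
  shows "H2_inner f f = of_real ((H2_norm f)\<^sup>2)"
  using assms has_sum_of_real[OF H2_norm_has_sum[OF assms], where 'a = complex]
  by (intro H2_inner_eqI) (auto simp flip: complex_norm_square)

lemma H2_norm_eq_0_iff:
  assumes "f \<in> H2"
  shows "H2_norm f = 0 \<longleftrightarrow> f = (\<lambda>_. 0)"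
proof
  assume "H2_norm f = 0"
  then have "((\<lambda>n. (cmod (taylor_coeff f n))\<^sup>2) has_sum 0) UNIV"
    using H2_norm_has_sum[OF assms] by simp
  from nonneg_has_sum_le_0D[OF this] have "taylor_coeff f n = 0" for n by auto
  then show "f = (\<lambda>_. 0)" using assms by (intro H2_eqI) auto
qed (auto simp: H2_norm_def)

text \<open>With \<open>s\<close> the projection of \<open>f\<close> onto the span of the \<open>e x\<close>, the three products \<open>\<langle>f, s\<rangle>\<close>, \<open>\<langle>s, f\<rangle>\<close>
  and \<open>\<langle>s, s\<rangle>\<close> equal the left side, and \<open>\<langle>f - s, f - s\<rangle>\<close> is not negative.\<close>

lemma H2_bessel:
  assumes "finite F" "f \<in> H2" "\<And>x. x \<in> F \<Longrightarrow> e x \<in> H2"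
    and on: "\<And>x y. x \<in> F \<Longrightarrow> y \<in> F \<Longrightarrow> H2_inner (e x) (e y) = (if x = y then 1 else 0)"
  shows "(\<Sum>x\<in>F. (cmod (H2_inner f (e x)))\<^sup>2) \<le> (H2_norm f)\<^sup>2"
proof -
  define c where "c x = H2_inner f (e x)" for x
  define s where "s = (\<lambda>p. \<Sum>x\<in>F. c x * e x p)"
  define R where "R = (\<Sum>x\<in>F. (cmod (c x))\<^sup>2)"
  have s: "s \<in> H2" unfolding s_def using assms by (intro H2_sum_mem) auto
  have ip: "H2_inner h s = (\<Sum>x\<in>F. cnj (c x) * H2_inner h (e x))" if "h \<in> H2" for h
    unfolding s_def using assms that by (subst H2_inner_sum_right) auto
  have fs: "H2_inner f s = of_real R"
    using assms(2) by (simp add: ip R_def c_def[symmetric] mult.commute[of "cnj _"] flip: complex_norm_square)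
  have "H2_inner s (e x) = c x" if "x \<in> F" for x
  proof -
    have "H2_inner s (e x) = (\<Sum>y\<in>F. if x = y then c y else 0)"
      unfolding s_def using assms(3) that by (subst H2_inner_sum_left) (auto intro!: sum.cong simp: on)
    then show ?thesis using assms(1) that by simp
  qed
  then have ss: "H2_inner s s = of_real R"
    using s by (simp add: ip R_def mult.commute[of "cnj _"] flip: complex_norm_square)
  have sf: "H2_inner s f = of_real R"
    using fs H2_inner_commute[of s f] by simp
  have "of_real ((H2_norm (\<lambda>p. f p - s p))\<^sup>2) = H2_inner (\<lambda>p. f p - s p) (\<lambda>p. f p - s p)"
    using assms(2) s by (simp only: H2_inner_self H2_diff_mem)
  also have "\<dots> = of_real ((H2_norm f)\<^sup>2 - R)"
    using assms(2) s by (simp add: fs sf ss H2_inner_self)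
  finally have "(H2_norm (\<lambda>p. f p - s p))\<^sup>2 = (H2_norm f)\<^sup>2 - R"
    by (simp only: of_real_eq_iff)
  then have "R \<le> (H2_norm f)\<^sup>2" by (smt (verit) zero_le_power2)
  then show ?thesis by (simp add: R_def c_def)
qed

lemma H2_normalize:
  assumes "f \<in> H2" "f \<noteq> (\<lambda>_. 0)"
  defines "g \<equiv> (\<lambda>p. of_real (1 / H2_norm f) * f p)"
  shows "g \<in> H2" "H2_inner g g = 1"
proof -
  have "H2_norm f \<noteq> 0" using assms H2_norm_eq_0_iff by auto
  show "g \<in> H2"
    unfolding g_def using assms(1) by (rule H2_cmult_mem)
  have "H2_inner g g = of_real (1 / H2_norm f) * (of_real (1 / H2_norm f) * H2_inner f f)"
    unfolding g_def H2_inner_cmult_left[OF assms(1) \<open>g \<in> H2\<close>[unfolded g_def]]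
      H2_inner_cmult_right[OF assms(1) assms(1)] by simp
  then show "H2_inner g g = 1"
    using assms(1) \<open>H2_norm f \<noteq> 0\<close> by (simp add: H2_inner_self power2_eq_square)
qed

lemma H2_cauchy_schwarz:
  assumes "f \<in> H2" "g \<in> H2"
  shows "cmod (H2_inner f g) \<le> H2_norm f * H2_norm g"
proof (cases "g = (\<lambda>_. 0)")
  case False
  define e where "e = (\<lambda>p. of_real (1 / H2_norm g) * g p)"
  have e: "e \<in> H2" "H2_inner e e = 1"
    using H2_normalize[OF assms(2) False] by (simp_all add: e_def)
  have pos: "H2_norm g > 0" using False H2_norm_eq_0_iff[OF assms(2)] H2_norm_nonneg[of g] by linarith
  have "(cmod (H2_inner f e))\<^sup>2 \<le> (H2_norm f)\<^sup>2"
    using H2_bessel[of "{()}" f "\<lambda>_. e"] assms e by simp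
  then have "cmod (H2_inner f e) \<le> H2_norm f" by (rule power2_le_imp_le) simp
  moreover have "H2_inner f e = of_real (1 / H2_norm g) * H2_inner f g"
    unfolding e_def using assms by (subst H2_inner_cmult_right) auto
  ultimately show ?thesis using pos by (simp add: norm_mult norm_divide field_simps)
qed auto

text \<open>The reproducing kernel: pairing with it evaluates a function at \<open>q\<close>.\<close>

definition szego :: "complex \<times> complex \<Rightarrow> complex \<times> complex \<Rightarrow> complex" where
  "szego q = on_bidisk (\<lambda>p. 1 / ((1 - cnj (fst q) * fst p) * (1 - cnj (snd q) * snd p)))"

lemma szego:
  assumes "q \<in> bidisk"
  shows szego_mem: "szego q \<in> H2"
    and taylor_coeff_szego: "taylor_coeff (szego q) = (\<lambda>(i, j). cnj (fst q) ^ i * cnj (snd q) ^ j)"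
proof -
  define c where "c = (\<lambda>(i :: nat, j :: nat). cnj (fst q) ^ i * cnj (snd q) ^ j)"
  have *: "has_taylor (szego q) c"
    unfolding has_taylor_def
  proof safe
    fix z w assume zw: "(z, w) \<in> bidisk"
    have "cmod (cnj (fst q) * z) < 1" "cmod (cnj (snd q) * w) < 1"
      using assms zw by (auto simp: bidisk_def intro!: cmod_mult_less_one)
    from has_sum_bidisk_geometric[OF this]
    show "((\<lambda>(i, j). c (i, j) * z ^ i * w ^ j) has_sum szego q (z, w)) UNIV"
      using zw by (simp add: szego_def c_def on_bidisk_def power_mult_distrib algebra_simps)
  qed
  have "l2 c"
    unfolding c_def using assms by (intro l2_geometric) (auto simp: bidisk_def)
  from H2I[OF _ * this] show "szego q \<in> H2"
    "taylor_coeff (szego q) = (\<lambda>(i, j). cnj (fst q) ^ i * cnj (snd q) ^ j)"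
    unfolding c_def by (auto simp: szego_def on_bidisk_def)
qed

lemma H2_inner_szego:
  assumes "f \<in> H2" "q \<in> bidisk"
  shows "H2_inner f (szego q) = f q"
  using H2_has_sum[OF assms] assms szego[OF assms(2)]
  by (intro H2_inner_eqI) (simp_all add: case_prod_unfold mult_ac)

lemma H2_eval_bound:
  assumes "f \<in> H2" "q \<in> bidisk"
  shows "cmod (f q) \<le> H2_norm f * H2_norm (szego q)"
  using H2_cauchy_schwarz[OF assms(1) szego_mem[OF assms(2)]] H2_inner_szego[OF assms] by simp

definition H2_monomial :: "nat \<times> nat \<Rightarrow> complex \<times> complex \<Rightarrow> complex" where
  "H2_monomial n = on_bidisk (\<lambda>p. fst p ^ fst n * snd p ^ snd n)"

lemma H2_monomial:
  shows H2_monomial_mem [simp]: "H2_monomial n \<in> H2"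
    and taylor_coeff_monomial: "taylor_coeff (H2_monomial n) = (\<lambda>m. if m = n then 1 else 0)"
proof -
  have *: "has_taylor (H2_monomial n) (\<lambda>m. if m = n then 1 else 0)"
    unfolding has_taylor_def
  proof safe
    fix z w assume zw: "(z, w) \<in> bidisk"
    have "((\<lambda>(i, j). (if (i, j) = n then 1 else 0) * z ^ i * w ^ j) has_sum H2_monomial n (z, w)) {n}"
      using zw by (intro has_sum_finiteI) (auto simp: H2_monomial_def on_bidisk_def case_prod_unfold)
    then show "((\<lambda>(i, j). (if (i, j) = n then 1 else 0) * z ^ i * w ^ j) has_sum H2_monomial n (z, w)) UNIV"
      by (rule has_sum_cong_neutral[THEN iffD1, rotated -1]) (auto split: prod.splits)
  qed
  have "l2 (\<lambda>m. if m = n then 1 else 0)"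
    unfolding l2_def
    by (rule finite_nonzero_values_imp_summable_on) simp
  from H2I[OF _ * this] show "H2_monomial n \<in> H2"
    "taylor_coeff (H2_monomial n) = (\<lambda>m. if m = n then 1 else 0)"
    by (auto simp: H2_monomial_def on_bidisk_def)
qed

lemma H2_inner_monomial:
  assumes "f \<in> H2"
  shows "H2_inner f (H2_monomial n) = taylor_coeff f n"
proof -
  have "((\<lambda>m. taylor_coeff f m * cnj (taylor_coeff (H2_monomial n) m)) has_sum taylor_coeff f n) {n}"
    by (intro has_sum_finiteI) (auto simp: taylor_coeff_monomial)
  then have "((\<lambda>m. taylor_coeff f m * cnj (taylor_coeff (H2_monomial n) m)) has_sum taylor_coeff f n) UNIV"
    by (rule has_sum_cong_neutral[THEN iffD1, rotated -1]) (auto simp: taylor_coeff_monomial)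
  then show ?thesis using assms by (intro H2_inner_eqI) auto
qed

section \<open>Shifts\<close>

definition swap_vars :: "(complex \<times> complex \<Rightarrow> complex) \<Rightarrow> complex \<times> complex \<Rightarrow> complex" where
  "swap_vars f = (\<lambda>p. f (prod.swap p))"

lemma swap_in_bidisk [simp]: "prod.swap p \<in> bidisk \<longleftrightarrow> p \<in> bidisk"
  by (cases p) (auto simp: bidisk_def)

lemma swap_vars_swap_vars [simp]: "swap_vars (swap_vars f) = f"
  by (simp add: swap_vars_def)

lemma has_sum_swap_iff:
  "((\<lambda>n. f (prod.swap n)) has_sum s) UNIV \<longleftrightarrow> (f has_sum s) UNIV"
  by (rule has_sum_reindex_bij_betw) (auto intro!: bij_swap)

lemma swap_vars:
  assumes "f \<in> H2"
  shows swap_vars_mem [simp]: "swap_vars f \<in> H2"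
    and taylor_coeff_swap_vars: "taylor_coeff (swap_vars f) = (\<lambda>n. taylor_coeff f (prod.swap n))"
proof -
  have *: "has_taylor (swap_vars f) (\<lambda>n. taylor_coeff f (prod.swap n))"
    unfolding has_taylor_def
  proof safe
    fix z w assume "(z, w) \<in> bidisk"
    then have "prod.swap (z, w) \<in> bidisk" by (simp only: swap_in_bidisk)
    from H2_has_sum[OF assms this]
    have "((\<lambda>n. (case prod.swap n of (i, j) \<Rightarrow> taylor_coeff f (i, j) * w ^ i * z ^ j)) has_sum f (w, z)) UNIV"
      by (subst has_sum_swap_iff) simp
    then show "((\<lambda>(i, j). taylor_coeff f (prod.swap (i, j)) * z ^ i * w ^ j) has_sum swap_vars f (z, w)) UNIV"
      by (simp add: swap_vars_def prod.swap_def case_prod_unfold mult_ac)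
  qed
  have "(\<lambda>n. (cmod (taylor_coeff f (prod.swap n)))\<^sup>2) summable_on UNIV"
    using has_sum_swap_iff[THEN iffD2, OF H2_norm_has_sum[OF assms]] has_sum_imp_summable by blast
  then have l2: "l2 (\<lambda>n. taylor_coeff f (prod.swap n))" by (simp add: l2_def)
  show "swap_vars f \<in> H2" "taylor_coeff (swap_vars f) = (\<lambda>n. taylor_coeff f (prod.swap n))"
    by (rule H2I[OF _ * l2], simp add: swap_vars_def H2_outside assms)+
qed

lemma H2_inner_swap_vars:
  assumes "f \<in> H2" "g \<in> H2"
  shows "H2_inner (swap_vars f) (swap_vars g) = H2_inner f g"
proof (rule H2_inner_eqI)
  show "((\<lambda>n. taylor_coeff (swap_vars f) n * cnj (taylor_coeff (swap_vars g) n)) has_sum H2_inner f g) UNIV"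
    using H2_inner_has_sum[OF assms] assms
    by (simp add: taylor_coeff_swap_vars has_sum_swap_iff[of "\<lambda>n. taylor_coeff f n * cnj (taylor_coeff g n)"])
qed (use assms in auto)

lemma has_sum_shift:
  assumes "(f has_sum s) (UNIV :: (nat \<times> nat) set)"
  shows "((\<lambda>(i, j). case i of 0 \<Rightarrow> 0 | Suc k \<Rightarrow> f (k, j)) has_sum s) UNIV"
proof -
  let ?h = "\<lambda>(i :: nat, j :: nat). (Suc i, j)"
  let ?f = "\<lambda>(i, j). case i of 0 \<Rightarrow> 0 | Suc k \<Rightarrow> f (k, j)"
  have "inj ?h" by (auto simp: inj_on_def)
  from has_sum_reindex[OF this, of ?f s] assms
  have "(?f has_sum s) (range ?h)" by (simp add: o_def case_prod_unfold)
  then show ?thesis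
  proof (rule has_sum_cong_neutral[THEN iffD1, rotated -1])
    fix x assume "x \<in> UNIV - range ?h"
    then have "fst x = 0" by (cases x; cases "fst x") (auto simp: image_def)
    then show "?f x = 0" by (simp add: case_prod_unfold)
  qed auto
qed

lemma summable_on_unshift:
  assumes "f summable_on (UNIV :: (nat \<times> nat) set)"
  shows "(\<lambda>(i, j). f (Suc i, j) :: 'a :: banach) summable_on UNIV"
proof -
  let ?h = "\<lambda>(i :: nat, j :: nat). (Suc i, j)"
  have "inj ?h" by (auto simp: inj_on_def)
  moreover have "f summable_on range ?h"
    using assms summable_on_subset_banach by blast
  ultimately show ?thesis
    by (simp add: summable_on_reindex o_def case_prod_unfold)
qed

lemma mult_z:
  assumes "f \<in> H2"
  shows mult_z_mem [simp]: "mult_op fst f \<in> H2"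
    and taylor_coeff_mult_z: "taylor_coeff (mult_op fst f) = (\<lambda>(i, j). case i of 0 \<Rightarrow> 0 | Suc k \<Rightarrow> taylor_coeff f (k, j))"
proof -
  define c where "c = (\<lambda>(i, j). case i of 0 \<Rightarrow> 0 | Suc k \<Rightarrow> taylor_coeff f (k, j))"
  have *: "has_taylor (mult_op fst f) c"
    unfolding has_taylor_def
  proof safe
    fix z w assume "(z, w) \<in> bidisk"
    from has_sum_shift[OF has_sum_cmult_right[OF H2_has_sum[OF assms this], of z]]
    have "((\<lambda>(i, j). c (i, j) * z ^ i * w ^ j) has_sum z * f (z, w)) UNIV"
      by (rule has_sum_cong[THEN iffD1, rotated])
        (auto simp: c_def split: nat.splits)
    then show "((\<lambda>(i, j). c (i, j) * z ^ i * w ^ j) has_sum mult_op fst f (z, w)) UNIV"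
      by (simp add: mult_op_def)
  qed
  have l2: "l2 c"
    unfolding l2_def
    by (rule summable_on_cong[THEN iffD1, OF _ has_sum_imp_summable[OF has_sum_shift[OF H2_norm_has_sum[OF assms]]]])
      (auto simp: c_def split: nat.splits)
  show "mult_op fst f \<in> H2"
    by (rule H2I[OF _ * l2]) (simp add: mult_op_def H2_outside assms)
  show "taylor_coeff (mult_op fst f) = (\<lambda>(i, j). case i of 0 \<Rightarrow> 0 | Suc k \<Rightarrow> taylor_coeff f (k, j))"
    unfolding c_def[symmetric]
    by (rule H2I[OF _ * l2]) (simp add: mult_op_def H2_outside assms)
qed

lemma taylor_coeff_mult_z_simps [simp]:
  assumes "f \<in> H2"
  shows "taylor_coeff (mult_op fst f) (0, j) = 0"
    and "taylor_coeff (mult_op fst f) (Suc i, j) = taylor_coeff f (i, j)"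
  using assms by (simp_all add: taylor_coeff_mult_z)

lemma mult_z_eq_0D:
  assumes "f \<in> H2" "mult_op fst f = (\<lambda>_. 0)"
  shows "f = (\<lambda>_. 0)"
proof (rule H2_eqI)
  show "taylor_coeff f = taylor_coeff (\<lambda>_. 0)"
    using taylor_coeff_mult_z_simps(2)[OF assms(1)] assms(2) by (auto simp: fun_eq_iff)
qed (use assms in auto)

text \<open>The adjoint of multiplication by the first variable on the whole Hardy space.\<close>

definition backward_shift :: "(complex \<times> complex \<Rightarrow> complex) \<Rightarrow> complex \<times> complex \<Rightarrow> complex" where
  "backward_shift f = H2_of_coeffs (\<lambda>(i, j). taylor_coeff f (Suc i, j))"

lemma backward_shift:
  assumes "f \<in> H2"
  shows backward_shift_mem [simp]: "backward_shift f \<in> H2"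
    and taylor_coeff_backward_shift: "taylor_coeff (backward_shift f) = (\<lambda>(i, j). taylor_coeff f (Suc i, j))"
proof -
  have "l2 (\<lambda>(i, j). taylor_coeff f (Suc i, j))"
    using summable_on_unshift[OF has_sum_imp_summable[OF H2_norm_has_sum[OF assms]]]
    by (simp add: l2_def case_prod_unfold)
  from H2_of_coeffs[OF this] show "backward_shift f \<in> H2"
    "taylor_coeff (backward_shift f) = (\<lambda>(i, j). taylor_coeff f (Suc i, j))"
    by (simp_all add: backward_shift_def)
qed

lemma backward_shift_adjoint:
  assumes "f \<in> H2" "g \<in> H2"
  shows "H2_inner (mult_op fst f) g = H2_inner f (backward_shift g)"
proof (rule H2_inner_eqI)
  show "((\<lambda>n. taylor_coeff (mult_op fst f) n * cnj (taylor_coeff g n)) has_sum H2_inner f (backward_shift g)) UNIV"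
    using has_sum_shift[OF H2_inner_has_sum[OF assms(1) backward_shift_mem[OF assms(2)]]]
    by (rule has_sum_cong[THEN iffD1, rotated])
      (use assms in \<open>auto simp: taylor_coeff_backward_shift taylor_coeff_mult_z split: nat.splits\<close>)
qed (use assms in auto)

lemma backward_shift_mult_z: "f \<in> H2 \<Longrightarrow> backward_shift (mult_op fst f) = f"
  by (rule H2_eqI) (auto simp: taylor_coeff_backward_shift)

lemma H2_inner_mult_z:
  assumes "f \<in> H2" "g \<in> H2"
  shows "H2_inner (mult_op fst f) (mult_op fst g) = H2_inner f g"
  using assms by (simp add: backward_shift_adjoint backward_shift_mult_z)

text \<open>Away from \<open>z = 0\<close> this is a formula for the values of the backward shift. It shows that the
  backward shift commutes with multiplication by functions of \<open>w\<close> alone.\<close>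

lemma mult_z_backward_shift:
  assumes f: "f \<in> H2" and p: "p \<in> bidisk"
  shows "fst p * backward_shift f p = f p - f (0, snd p)"
proof -
  \<comment> \<open>The part of the Taylor series without \<open>z\<close>, that is, the function \<open>f (0, w)\<close>.\<close>
  define c where "c = (\<lambda>(i :: nat, j). if i = 0 then taylor_coeff f (i, j) else 0)"
  define R where "R = H2_of_coeffs c"
  have "l2 c" using H2_l2[OF f] by (rule l2_dominated[where B = 1]) (auto simp: c_def)
  note R = H2_of_coeffs[OF this, folded R_def]
  have "f = (\<lambda>p. mult_op fst (backward_shift f) p + R p)"
    using f R by (intro H2_eqI) (auto simp: taylor_coeff_mult_z taylor_coeff_backward_shift c_def split: nat.splits)
  then have eq: "f q = fst q * backward_shift f q + R q" for q
    by (metis mult_op_def)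
  have "(0, snd p) \<in> bidisk" using p by (auto simp: bidisk_def)
  moreover have "(\<lambda>(i, j). c (i, j) * fst p ^ i * snd p ^ j) = (\<lambda>(i, j). c (i, j) * 0 ^ i * snd p ^ j)"
    by (auto simp: c_def)
  ultimately have "R p = R (0, snd p)"
    using p by (simp add: R_def H2_of_coeffs_def on_bidisk_def)
  then show ?thesis using eq[of p] eq[of "(0, snd p)"] by simp
qed

text \<open>The coefficients \<open>d\<close> of the quotient solve \<open>d = c + a S d\<close>, where \<open>S\<close> is the shift in the first
  index. On a square of indices \<open>S\<close> does not increase the Euclidean norm, so the triangle inequality
  gives \<open>\<parallel>d\<parallel> \<le> \<parallel>c\<parallel> + \<bar>a\<bar> \<parallel>d\<parallel>\<close> on every square, with finite norms, and hence a bound that does not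
  depend on the square.\<close>

lemma H2_divide_one_minus:
  assumes f: "f \<in> H2" and a: "cmod a < 1"
  shows "(\<lambda>p. f p / (1 - a * fst p)) \<in> H2"
proof -
  define c where "c = taylor_coeff f"
  define d where "d = (\<lambda>(i, j). \<Sum>k\<le>i. a ^ (i - k) * c (k, j))"
  have d_0: "d (0, j) = c (0, j)" for j by (simp add: d_def)
  have d_Suc: "d (Suc i, j) = c (Suc i, j) + a * d (i, j)" for i j
    by (simp add: d_def sum_distrib_left Suc_diff_le mult.assoc)
  define B where "B = H2_norm f / (1 - cmod a)"
  have "(\<Sum>x\<in>F. (cmod (d x))\<^sup>2) \<le> B\<^sup>2" if "finite F" for F
  proof -
    have "finite (fst ` F \<union> snd ` F)" using that by auto
    then obtain n where n: "\<And>x. x \<in> fst ` F \<union> snd ` F \<Longrightarrow> x < n"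
      unfolding finite_nat_set_iff_bounded by blast
    define S where "S = {..<n} \<times> {..<n}"
    have FS: "F \<subseteq> S" using n by (fastforce simp: S_def)
    have [simp]: "finite S" by (simp add: S_def)
    \<comment> \<open>The shift of \<open>d\<close>.\<close>
    define e where "e = (\<lambda>(i, j). case i of 0 \<Rightarrow> 0 | Suc k \<Rightarrow> d (k, j))"
    have de: "d x = c x + a * e x" for x
      by (cases x; cases "fst x") (auto simp: e_def d_0 d_Suc)
    have shift_le: "(\<Sum>x\<in>S. (cmod (e x))\<^sup>2) \<le> (\<Sum>x\<in>S. (cmod (d x))\<^sup>2)"
    proof -
      have "(\<Sum>x\<in>S. (cmod (e x))\<^sup>2) = (\<Sum>x\<in>S \<inter> {x. fst x \<noteq> 0}. (cmod (e x))\<^sup>2)"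
        by (intro sum.mono_neutral_right) (auto simp: e_def split: nat.splits)
      also have "\<dots> = (\<Sum>x\<in>(\<lambda>(i, j). (i - 1, j)) ` (S \<inter> {x. fst x \<noteq> 0}). (cmod (d x))\<^sup>2)"
        by (subst sum.reindex) (auto simp: inj_on_def e_def intro!: sum.cong split: nat.splits)
      also have "\<dots> \<le> (\<Sum>x\<in>S. (cmod (d x))\<^sup>2)"
        by (intro sum_mono2) (auto simp: S_def)
      finally show ?thesis .
    qed
    have "L2_set (\<lambda>x. cmod (d x)) S \<le> L2_set (\<lambda>x. cmod (c x) + cmod a * cmod (e x)) S"
      by (intro L2_set_mono) (auto simp: de norm_triangle_le norm_mult)
    also have "\<dots> \<le> L2_set (\<lambda>x. cmod (c x)) S + L2_set (\<lambda>x. cmod a * cmod (e x)) S"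
      by (rule L2_set_triangle_ineq)
    also have "L2_set (\<lambda>x. cmod a * cmod (e x)) S = cmod a * L2_set (\<lambda>x. cmod (e x)) S"
      by (simp add: L2_set_right_distrib)
    also have "\<dots> \<le> cmod a * L2_set (\<lambda>x. cmod (d x)) S"
      using shift_le by (intro mult_left_mono) (auto simp: L2_set_def)
    also have "L2_set (\<lambda>x. cmod (c x)) S \<le> H2_norm f"
      unfolding H2_norm_def L2_set_def c_def using l2_sum_le[OF H2_l2[OF f] \<open>finite S\<close>] by simp
    finally have "L2_set (\<lambda>x. cmod (d x)) S \<le> B"
      using a by (simp add: B_def field_simps)
    then have "(L2_set (\<lambda>x. cmod (d x)) S)\<^sup>2 \<le> B\<^sup>2"
      by (intro power_mono) auto
    then have "(\<Sum>x\<in>S. (cmod (d x))\<^sup>2) \<le> B\<^sup>2"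
      by (simp add: L2_set_def sum_nonneg)
    moreover have "(\<Sum>x\<in>F. (cmod (d x))\<^sup>2) \<le> (\<Sum>x\<in>S. (cmod (d x))\<^sup>2)"
      using FS by (intro sum_mono2) auto
    ultimately show ?thesis by linarith
  qed
  then have "l2 d" by (rule l2_boundedI)
  note g = H2_of_coeffs[OF this]
  define g where "g = H2_of_coeffs d"
  have g_mem: "g \<in> H2" and g_coeff: "taylor_coeff g = d" using g by (simp_all add: g_def)
  have eq: "f = (\<lambda>p. g p - a * mult_op fst g p)"
  proof (rule H2_eqI)
    have "c (i, j) = d (i, j) - a * taylor_coeff (mult_op fst g) (i, j)" for i j
      by (cases i) (simp_all add: g_mem g_coeff d_0 d_Suc)
    then show "taylor_coeff f = taylor_coeff (\<lambda>p. g p - a * mult_op fst g p)"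
      using g_mem by (auto simp: g_coeff c_def)
  qed (use f g_mem in auto)
  have "f p / (1 - a * fst p) = g p" for p
  proof (cases "p \<in> bidisk")
    case True
    then have "cmod (a * fst p) < 1" using a by (intro cmod_mult_less_one) (auto simp: bidisk_def)
    then have "1 - a * fst p \<noteq> 0" by auto
    moreover have "f p = g p * (1 - a * fst p)"
      by (subst eq) (simp add: mult_op_def algebra_simps)
    ultimately show ?thesis by simp
  qed (simp add: H2_outside f g_mem)
  then have "(\<lambda>p. f p / (1 - a * fst p)) = g" by auto
  then show ?thesis using g_mem by simp
qed

section \<open>Multiplication by a Blaschke factor\<close>

abbreviation blaschke_z :: "complex \<Rightarrow> complex \<times> complex \<Rightarrow> complex" where
  "blaschke_z a \<equiv> \<lambda>(z, w). blaschke a z"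

lemma one_minus_cnj_mult_neq_0:
  assumes "cmod a < 1" "cmod z < 1"
  shows "1 - cnj a * z \<noteq> 0"
  using cmod_mult_less_one[of "cnj a" z] assms by auto

lemma sqrt_one_minus_cmod_square:
  assumes "cmod a < 1"
  shows "complex_of_real (sqrt (1 - (cmod a)\<^sup>2)) * of_real (sqrt (1 - (cmod a)\<^sup>2)) = 1 - a * cnj a"
proof -
  have "(cmod a)\<^sup>2 \<le> 1" using assms by (simp add: power_le_one)
  then have "sqrt (1 - (cmod a)\<^sup>2) * sqrt (1 - (cmod a)\<^sup>2) = 1 - (cmod a)\<^sup>2" by simp
  then show ?thesis
    by (metis of_real_mult of_real_diff of_real_1 complex_norm_square)
qed

text \<open>Dividing by the denominator \<open>1 - cnj a z\<close> first expresses both \<open>f\<close> and its product with the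
  Blaschke factor through the shift alone.\<close>

lemma mult_blaschke_z_eq:
  assumes "f \<in> H2" "cmod a < 1"
  defines "g \<equiv> (\<lambda>p. f p / (1 - cnj a * fst p))"
  shows "g \<in> H2"
    and "mult_op (blaschke_z a) f = (\<lambda>p. a * g p - mult_op fst g p)"
    and "f = (\<lambda>p. g p - cnj a * mult_op fst g p)"
proof -
  show "g \<in> H2" unfolding g_def using assms by (intro H2_divide_one_minus) auto
  show "mult_op (blaschke_z a) f = (\<lambda>p. a * g p - mult_op fst g p)"
    by (auto simp: mult_op_def blaschke_def g_def case_prod_unfold diff_divide_distrib algebra_simps)
  show "f = (\<lambda>p. g p - cnj a * mult_op fst g p)"
  proof
    fix p
    show "f p = g p - cnj a * mult_op fst g p"
    proof (cases "p \<in> bidisk")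
      case True
      then have "1 - cnj a * fst p \<noteq> 0"
        using assms(2) by (intro one_minus_cnj_mult_neq_0) (auto simp: bidisk_def)
      moreover have "g p - cnj a * mult_op fst g p = g p * (1 - cnj a * fst p)"
        by (simp add: mult_op_def algebra_simps)
      ultimately show ?thesis by (simp add: g_def)
    qed (use assms(1) in \<open>simp add: H2_outside g_def mult_op_def\<close>)
  qed
qed

lemma mult_blaschke_z_mem [simp]:
  assumes "f \<in> H2" "cmod a < 1"
  shows "mult_op (blaschke_z a) f \<in> H2"
  unfolding mult_blaschke_z_eq(2)[OF assms]
  by (intro H2_diff_mem H2_cmult_mem mult_z_mem mult_blaschke_z_eq(1) assms)

text \<open>In terms of \<open>g = f / (1 - cnj a z)\<close> and \<open>k = h / (1 - cnj a z)\<close> the claim is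
  \<open>\<langle>(a - z) g, (a - z) k\<rangle> = \<langle>(1 - cnj a z) g, (1 - cnj a z) k\<rangle>\<close>. After expansion both sides have
  the same terms, because multiplication by \<open>z\<close> is isometric.\<close>

lemma H2_inner_mult_blaschke_z:
  assumes "f \<in> H2" "h \<in> H2" "cmod a < 1"
  shows "H2_inner (mult_op (blaschke_z a) f) (mult_op (blaschke_z a) h) = H2_inner f h"
proof -
  obtain g where g: "g \<in> H2" "mult_op (blaschke_z a) f = (\<lambda>p. a * g p - mult_op fst g p)"
      "f = (\<lambda>p. g p - cnj a * mult_op fst g p)"
    using mult_blaschke_z_eq[OF assms(1,3)] by blast
  obtain k where k: "k \<in> H2" "mult_op (blaschke_z a) h = (\<lambda>p. a * k p - mult_op fst k p)"
      "h = (\<lambda>p. k p - cnj a * mult_op fst k p)"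
    using mult_blaschke_z_eq[OF assms(2,3)] by blast
  have "H2_inner f h = H2_inner (\<lambda>p. g p - cnj a * mult_op fst g p) (\<lambda>p. k p - cnj a * mult_op fst k p)"
    using g(3) k(3) by simp
  also have "\<dots> = H2_inner (\<lambda>p. a * g p - mult_op fst g p) (\<lambda>p. a * k p - mult_op fst k p)"
    using g(1) k(1) by (simp add: H2_inner_mult_z algebra_simps)
  finally show ?thesis using g(2) k(2) by simp
qed

text \<open>The Szego kernel of the disk at \<open>a\<close> in the first variable times \<open>w ^ j\<close>. Pairing with it
  evaluates at \<open>z = a\<close>, where the Blaschke factor vanishes, and extracts the coefficient of \<open>w ^ j\<close>.
  The recursion for these functions replaces any computation with their coefficients.\<close>

definition szego_slice :: "complex \<Rightarrow> nat \<Rightarrow> complex \<times> complex \<Rightarrow> complex" where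
  "szego_slice a j = (\<lambda>p. H2_monomial (0, j) p / (1 - cnj a * fst p))"

lemma szego_slice_mem [simp]: "cmod a < 1 \<Longrightarrow> szego_slice a j \<in> H2"
  unfolding szego_slice_def by (intro H2_divide_one_minus) auto

lemma szego_slice_eq:
  assumes "cmod a < 1"
  shows "szego_slice a j = (\<lambda>p. H2_monomial (0, j) p + cnj a * mult_op fst (szego_slice a j) p)"
proof
  fix p
  show "szego_slice a j p = H2_monomial (0, j) p + cnj a * mult_op fst (szego_slice a j) p"
    using fun_cong[OF mult_blaschke_z_eq(3)[OF H2_monomial_mem[of "(0, j)"] assms], of p]
    unfolding szego_slice_def by (simp add: algebra_simps)
qed

lemma H2_inner_blaschke_szego_slice:
  assumes "f \<in> H2" "cmod a < 1"
  shows "H2_inner (mult_op (blaschke_z a) f) (szego_slice a j) = 0"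
proof -
  obtain g where g: "g \<in> H2" "mult_op (blaschke_z a) f = (\<lambda>p. a * g p - mult_op fst g p)"
    using mult_blaschke_z_eq[OF assms] by blast
  have "H2_inner (mult_op fst g) (szego_slice a j) = H2_inner (mult_op fst g)
      (\<lambda>p. H2_monomial (0, j) p + cnj a * mult_op fst (szego_slice a j) p)"
    using szego_slice_eq[OF assms(2), of j] by simp
  also have "\<dots> = a * H2_inner g (szego_slice a j)"
    using g(1) assms(2) by (simp add: H2_inner_monomial H2_inner_mult_z)
  finally show ?thesis
    unfolding g(2) using g(1) assms(2) by simp
qed

lemma H2_inner_szego_slice:
  assumes "cmod a < 1"
  shows "(1 - a * cnj a) * H2_inner (szego_slice a j) (szego_slice a l) = (if j = l then 1 else 0)"
proof -
  let ?y = "szego_slice a"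
  have orth: "H2_inner (H2_monomial (0, i)) (mult_op fst f) = 0" if "f \<in> H2" for i f
    using that by (subst H2_inner_commute) (simp add: H2_inner_monomial)
  have "H2_inner (?y j) (?y l) = H2_inner (\<lambda>p. H2_monomial (0, j) p + cnj a * mult_op fst (?y j) p)
      (\<lambda>p. H2_monomial (0, l) p + cnj a * mult_op fst (?y l) p)"
    using szego_slice_eq[OF assms, of j] szego_slice_eq[OF assms, of l] by simp
  also have "\<dots> = (if j = l then 1 else 0) + a * cnj a * H2_inner (?y j) (?y l)"
    using assms by (simp add: H2_inner_monomial H2_inner_mult_z orth taylor_coeff_monomial)
  finally show ?thesis by (simp add: algebra_simps)
qed

text \<open>The Szego kernel of the disk at \<open>a\<close>, divided by its norm.\<close>

definition szego1 :: "complex \<Rightarrow> complex \<Rightarrow> complex" where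
  "szego1 a z = of_real (sqrt (1 - (cmod a)\<^sup>2)) / (1 - cnj a * z)"

text \<open>These are the images of the monomials under the operator \<open>moebius_z a\<close> below. Their
  orthonormality is what makes that operator contractive.\<close>

definition blaschke_basis :: "complex \<Rightarrow> nat \<times> nat \<Rightarrow> complex \<times> complex \<Rightarrow> complex" where
  "blaschke_basis a n =
     on_bidisk (\<lambda>p. szego1 a (fst p) * blaschke a (fst p) ^ fst n * snd p ^ snd n)"

lemma blaschke_basis_0:
  "blaschke_basis a (0, j) = (\<lambda>p. of_real (sqrt (1 - (cmod a)\<^sup>2)) * szego_slice a j p)"
  by (auto simp: blaschke_basis_def szego1_def szego_slice_def H2_monomial_def on_bidisk_def)

lemma blaschke_basis_Suc:
  "blaschke_basis a (Suc i, j) = mult_op (blaschke_z a) (blaschke_basis a (i, j))"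
  by (auto simp: blaschke_basis_def mult_op_def on_bidisk_def)

lemma blaschke_basis_mem [simp]:
  assumes "cmod a < 1"
  shows "blaschke_basis a n \<in> H2"
proof (cases n)
  case (Pair i j)
  have "blaschke_basis a (i, j) \<in> H2"
    using assms by (induction i) (simp_all add: blaschke_basis_0 blaschke_basis_Suc)
  then show ?thesis using Pair by simp
qed

lemma blaschke_basis_orthonormal:
  assumes "cmod a < 1"
  shows "H2_inner (blaschke_basis a m) (blaschke_basis a n) = (if m = n then 1 else 0)"
proof -
  have Suc_0: "H2_inner (blaschke_basis a (Suc i, j)) (blaschke_basis a (0, l)) = 0" for i j l
    using assms by (simp add: blaschke_basis_0 blaschke_basis_Suc[of a i j] H2_inner_blaschke_szego_slice)
  have "H2_inner (blaschke_basis a (i, j)) (blaschke_basis a (k, l)) = (if (i, j) = (k, l) then 1 else 0)" for i j k l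
  proof (induction i arbitrary: k)
    case 0
    show ?case
    proof (cases k)
      case 0
      have "complex_of_real (sqrt (1 - (cmod a)\<^sup>2)) * of_real (sqrt (1 - (cmod a)\<^sup>2)) = 1 - a * cnj a"
        using assms(1) by (rule sqrt_one_minus_cmod_square)
      then show ?thesis
        using assms H2_inner_szego_slice[OF assms, of j l] 0
        by (simp add: blaschke_basis_0 mult.assoc[symmetric])
    next
      case (Suc k')
      then show ?thesis using Suc_0[of k' l j] H2_inner_commute by (metis complex_cnj_zero nat.distinct(1) prod.inject)
    qed
  next
    case (Suc i)
    show ?case
    proof (cases k)
      case 0
      then show ?thesis using Suc_0 by simp
    next
      case (Suc k')
      then show ?thesis
        using assms Suc.IH[of k'] by (simp add: blaschke_basis_Suc H2_inner_mult_blaschke_z)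
    qed
  qed
  then show ?thesis by (cases m, cases n) auto
qed

section \<open>The unitary operator of a disk automorphism\<close>

lemma blaschke_identity:
  assumes "cmod a < 1" "cmod z < 1"
  shows "1 - blaschke a z * cnj (blaschke a z) = (1 - a * cnj a) * (1 - z * cnj z) / ((1 - cnj a * z) * (1 - a * cnj z))"
proof -
  have "1 - cnj a * z \<noteq> 0" using assms by (rule one_minus_cnj_mult_neq_0)
  moreover have "1 - a * cnj z \<noteq> 0"
    using one_minus_cnj_mult_neq_0[of "cnj a" "cnj z"] assms by simp
  moreover have "1 - ((a - z) / d) * ((cnj a - cnj z) / e) = (d * e - (a - z) * (cnj a - cnj z)) / (d * e)"
    if "d \<noteq> 0" "e \<noteq> 0" for d e
    using that by (simp add: field_simps)
  ultimately have "1 - blaschke a z * cnj (blaschke a z) =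
      ((1 - cnj a * z) * (1 - a * cnj z) - (a - z) * (cnj a - cnj z)) / ((1 - cnj a * z) * (1 - a * cnj z))"
    by (simp add: blaschke_def)
  also have "(1 - cnj a * z) * (1 - a * cnj z) - (a - z) * (cnj a - cnj z) = (1 - a * cnj a) * (1 - z * cnj z)"
    by (simp add: algebra_simps)
  finally show ?thesis .
qed

lemma cmod_blaschke_less_one:
  assumes "cmod a < 1" "cmod z < 1"
  shows "cmod (blaschke a z) < 1"
proof -
  have "of_real (1 - (cmod (blaschke a z))\<^sup>2) = 1 - blaschke a z * cnj (blaschke a z)"
    unfolding of_real_diff of_real_1 complex_norm_square ..
  also have "\<dots> = (1 - a * cnj a) * (1 - z * cnj z) / ((1 - cnj a * z) * cnj (1 - cnj a * z))"
    using blaschke_identity[OF assms] by simp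
  also have "\<dots> = of_real ((1 - (cmod a)\<^sup>2) * (1 - (cmod z)\<^sup>2) / (cmod (1 - cnj a * z))\<^sup>2)"
    unfolding of_real_divide of_real_mult of_real_diff of_real_1 complex_norm_square ..
  finally have "1 - (cmod (blaschke a z))\<^sup>2 = (1 - (cmod a)\<^sup>2) * (1 - (cmod z)\<^sup>2) / (cmod (1 - cnj a * z))\<^sup>2"
    by (simp only: of_real_eq_iff)
  also have "\<dots> > 0"
    using assms one_minus_cnj_mult_neq_0[OF assms]
    by (intro divide_pos_pos mult_pos_pos) (auto simp: power_less_one_iff)
  finally have "(cmod (blaschke a z))\<^sup>2 < 1" by simp
  then show ?thesis by (simp add: power_less_one_iff)
qed

lemma szego1_blaschke:
  assumes "cmod a < 1" "cmod z < 1"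
  shows blaschke_blaschke: "blaschke a (blaschke a z) = z"
    and szego1_szego1: "szego1 a z * szego1 a (blaschke a z) = 1"
proof -
  let ?d = "1 - cnj a * z"
  have d: "?d \<noteq> 0" using assms by (rule one_minus_cnj_mult_neq_0)
  have a: "1 - a * cnj a \<noteq> 0"
    using one_minus_cnj_mult_neq_0[OF assms(1,1)] by (simp add: mult.commute)
  have den: "1 - cnj a * blaschke a z = (1 - a * cnj a) / ?d"
    using d by (simp add: blaschke_def field_simps)
  have num: "a - blaschke a z = z * (1 - a * cnj a) / ?d"
    using d by (simp add: blaschke_def field_simps)
  have "blaschke a (blaschke a z) = (a - blaschke a z) / (1 - cnj a * blaschke a z)"
    by (rule blaschke_def)
  then show "blaschke a (blaschke a z) = z"
    unfolding den num using a d by simp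
  have "complex_of_real (sqrt (1 - (cmod a)\<^sup>2)) * of_real (sqrt (1 - (cmod a)\<^sup>2)) = 1 - a * cnj a"
    using assms(1) by (rule sqrt_one_minus_cmod_square)
  then show "szego1 a z * szego1 a (blaschke a z) = 1"
    unfolding szego1_def den using a d by simp
qed

text \<open>Composition with the automorphism in the first variable, weighted so as to be isometric. The
  automorphism is its own inverse, and the weights are chosen so that the operator is, too.\<close>

definition moebius_z :: "complex \<Rightarrow> (complex \<times> complex \<Rightarrow> complex) \<Rightarrow> complex \<times> complex \<Rightarrow> complex" where
  "moebius_z a f = on_bidisk (\<lambda>p. szego1 a (fst p) * f (blaschke a (fst p), snd p))"

lemma szego1_norm_square:
  assumes "cmod a < 1" "cmod z < 1"
  shows "szego1 a z * cnj (szego1 a z) / (1 - blaschke a z * cnj (blaschke a z)) = 1 / (1 - z * cnj z)"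
proof -
  have d: "1 - cnj a * z \<noteq> 0" using assms by (rule one_minus_cnj_mult_neq_0)
  have d': "1 - a * cnj z \<noteq> 0"
    using one_minus_cnj_mult_neq_0[of "cnj a" "cnj z"] assms by simp
  have a: "1 - a * cnj a \<noteq> 0"
    using one_minus_cnj_mult_neq_0[OF assms(1,1)] by (simp add: mult.commute)
  have "complex_of_real (sqrt (1 - (cmod a)\<^sup>2)) * of_real (sqrt (1 - (cmod a)\<^sup>2)) = 1 - a * cnj a"
    using assms(1) by (rule sqrt_one_minus_cmod_square)
  then have "szego1 a z * cnj (szego1 a z) = (1 - a * cnj a) / ((1 - cnj a * z) * (1 - a * cnj z))"
    by (simp add: szego1_def)
  then show ?thesis
    unfolding blaschke_identity[OF assms] using a d d' by simp
qed

text \<open>The coefficients have to be shown to belong to the function \<open>moebius_z a f\<close>. At a point \<open>(z, w)\<close>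
  its value is \<open>\<langle>f, \<kappa> K\<rangle>\<close>, where \<open>K\<close> is the Szego kernel at \<open>q = (blaschke a z, w)\<close> and
  \<open>\<kappa> = cnj (szego1 a z)\<close>. So it suffices that the finite sums of \<open>cnj (z ^ i * w ^ j) E (i, j)\<close>,
  with \<open>E\<close> the Blaschke basis, tend to \<open>\<kappa> K\<close> in norm. Their squared distance to \<open>\<kappa> K\<close> can be
  computed exactly: by orthonormality and by evaluation at \<open>q\<close> it is the difference between
  \<open>\<parallel>\<kappa> K\<parallel>\<^sup>2\<close> and a partial sum of the geometric series with that value.\<close>

lemma moebius_z_has_taylor:
  assumes f: "f \<in> H2" and a: "cmod a < 1"
  shows "has_taylor (moebius_z a f) (\<lambda>n. H2_inner f (blaschke_basis a n))"
  unfolding has_taylor_def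
proof safe
  fix z w assume zw: "(z, w) \<in> bidisk"
  then have z: "cmod z < 1" and w: "cmod w < 1" by (auto simp: bidisk_def)
  define q where "q = (blaschke a z, w)"
  have q: "q \<in> bidisk"
    using cmod_blaschke_less_one[OF a z] w by (simp add: q_def bidisk_def)
  define \<kappa> where "\<kappa> = cnj (szego1 a z)"
  define mon where "mon n = z ^ fst n * w ^ snd n" for n :: "nat \<times> nat"
  define T where "T = (cmod \<kappa>)\<^sup>2 * (H2_norm (szego q))\<^sup>2"
  let ?E = "blaschke_basis a"
  have E_q: "cnj \<kappa> * ?E n q = mon n" for n
  proof -
    have "cnj \<kappa> * ?E n q = (szego1 a z * szego1 a (blaschke a z)) * blaschke a (blaschke a z) ^ fst n * w ^ snd n"
      using q by (simp add: blaschke_basis_def on_bidisk_def q_def \<kappa>_def mult_ac)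
    then show ?thesis by (simp add: szego1_blaschke[OF a z] mon_def)
  qed
  have T: "((\<lambda>n. (cmod (mon n))\<^sup>2) has_sum T) UNIV"
  proof -
    have "cmod (z * cnj z) < 1" "cmod (w * cnj w) < 1"
      using z w by (auto intro!: cmod_mult_less_one)
    from has_sum_bidisk_geometric[OF this]
    have "((\<lambda>n. complex_of_real ((cmod (mon n))\<^sup>2)) has_sum 1 / ((1 - z * cnj z) * (1 - w * cnj w))) UNIV"
      unfolding complex_norm_square mon_def by (simp add: case_prod_unfold power_mult_distrib mult_ac)
    also have "1 / ((1 - z * cnj z) * (1 - w * cnj w)) = of_real T"
    proof -
      have "complex_of_real T = cnj \<kappa> * \<kappa> * H2_inner (szego q) (szego q)"
        using H2_inner_self[OF szego_mem[OF q]] by (simp add: T_def complex_norm_square mult_ac del: of_real_power)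
      also have "H2_inner (szego q) (szego q) = szego q q"
        by (rule H2_inner_szego[OF szego_mem[OF q] q])
      also have "cnj \<kappa> * \<kappa> * szego q q =
          (szego1 a z * cnj (szego1 a z) / (1 - blaschke a z * cnj (blaschke a z))) / (1 - w * cnj w)"
        using q by (simp add: szego_def on_bidisk_def q_def \<kappa>_def mult_ac)
      also have "\<dots> = 1 / ((1 - z * cnj z) * (1 - w * cnj w))"
        by (simp add: szego1_norm_square[OF a z])
      finally show ?thesis ..
    qed
    finally show ?thesis by (simp only: has_sum_of_real_iff)
  qed
  \<comment> \<open>The error of the finite sum over \<open>F\<close>.\<close>
  define D where "D F = (\<lambda>p. (\<Sum>n\<in>F. cnj (mon n) * ?E n p) - \<kappa> * szego q p)" for F
  have dist: "(H2_norm (D F))\<^sup>2 = T - (\<Sum>n\<in>F. (cmod (mon n))\<^sup>2)" if F: "finite F" for F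
  proof -
    define s where "s = (\<lambda>p. \<Sum>n\<in>F. cnj (mon n) * ?E n p)"
    define R where "R = (\<Sum>n\<in>F. (cmod (mon n))\<^sup>2)"
    have s: "s \<in> H2" unfolding s_def using a by (intro H2_sum_mem) auto
    have sE: "H2_inner s (?E n) = cnj (mon n)" if "n \<in> F" for n
    proof -
      have "H2_inner s (?E n) = (\<Sum>m\<in>F. if m = n then cnj (mon m) else 0)"
        unfolding s_def using a by (subst H2_inner_sum_left) (auto intro!: sum.cong simp: blaschke_basis_orthonormal)
      then show ?thesis using F that by simp
    qed
    have "H2_inner h s = (\<Sum>n\<in>F. mon n * H2_inner h (?E n))" if "h \<in> H2" for h
      unfolding s_def using a that by (subst H2_inner_sum_right) auto
    from this[OF s] have "H2_inner s s = (\<Sum>n\<in>F. mon n * H2_inner s (?E n))" .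
    also have "\<dots> = of_real R" by (simp add: sE R_def flip: complex_norm_square)
    finally have ss: "H2_inner s s = of_real R" .
    have "H2_inner s (szego q) = (\<Sum>n\<in>F. cnj (mon n) * ?E n q)"
      using H2_inner_szego[OF s q] by (simp add: s_def)
    then have "cnj \<kappa> * H2_inner s (szego q) = (\<Sum>n\<in>F. cnj (mon n) * (cnj \<kappa> * ?E n q))"
      by (simp add: sum_distrib_left mult_ac)
    also have "\<dots> = of_real R" unfolding E_q R_def by (simp add: mult.commute[of "cnj _"] flip: complex_norm_square)
    finally have sK: "cnj \<kappa> * H2_inner s (szego q) = of_real R" .
    then have Ks: "\<kappa> * H2_inner (szego q) s = of_real R"
      by (metis H2_inner_commute complex_cnj_cnj complex_cnj_complex_of_real complex_cnj_mult)
    have KK: "\<kappa> * (cnj \<kappa> * H2_inner (szego q) (szego q)) = of_real T"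
      using H2_inner_self[OF szego_mem[OF q]] by (simp add: T_def complex_norm_square mult_ac del: of_real_power)
    have "of_real ((H2_norm (D F))\<^sup>2) = H2_inner (\<lambda>p. s p - \<kappa> * szego q p) (\<lambda>p. s p - \<kappa> * szego q p)"
      using H2_inner_self[OF H2_diff_mem[OF s H2_cmult_mem[OF szego_mem[OF q]]]]
      by (simp add: D_def s_def del: of_real_power)
    also have "\<dots> = of_real (T - R)"
      using s szego_mem[OF q] by (simp add: ss sK Ks KK right_diff_distrib)
    finally show ?thesis unfolding R_def by (simp only: of_real_eq_iff)
  qed
  have D_mem: "D F \<in> H2" for F
    unfolding D_def using a szego_mem[OF q] by (intro H2_diff_mem H2_sum_mem H2_cmult_mem) auto
  have ipD: "H2_inner f (D F) = (\<Sum>n\<in>F. mon n * H2_inner f (?E n)) - szego1 a z * f q" for F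
    unfolding D_def using f a szego_mem[OF q]
    by (subst H2_inner_diff_right) (auto simp: H2_sum_mem H2_inner_sum_right H2_inner_szego[OF f q] \<kappa>_def)
  have lim: "((\<lambda>F. H2_norm f * sqrt (T - (\<Sum>n\<in>F. (cmod (mon n))\<^sup>2))) \<longlongrightarrow> H2_norm f * sqrt (T - T))
      (finite_subsets_at_top UNIV)"
    using T unfolding has_sum_def by (intro tendsto_intros)
  have "((\<lambda>F. (\<Sum>n\<in>F. mon n * H2_inner f (?E n)) - szego1 a z * f q) \<longlongrightarrow> 0) (finite_subsets_at_top UNIV)"
  proof (rule Lim_null_comparison)
    show "\<forall>\<^sub>F F in finite_subsets_at_top UNIV. norm ((\<Sum>n\<in>F. mon n * H2_inner f (?E n)) - szego1 a z * f q)
        \<le> H2_norm f * sqrt (T - (\<Sum>n\<in>F. (cmod (mon n))\<^sup>2))"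
    proof (rule eventually_finite_subsets_at_top_weakI)
      fix F :: "(nat \<times> nat) set" assume F: "finite F"
      have "H2_norm (D F) = sqrt (T - (\<Sum>n\<in>F. (cmod (mon n))\<^sup>2))"
        using dist[OF F] by (metis H2_norm_nonneg real_sqrt_unique)
      then show "norm ((\<Sum>n\<in>F. mon n * H2_inner f (?E n)) - szego1 a z * f q)
        \<le> H2_norm f * sqrt (T - (\<Sum>n\<in>F. (cmod (mon n))\<^sup>2))"
        using H2_cauchy_schwarz[OF f D_mem[of F]] by (simp add: ipD)
    qed
  qed (use lim in simp)
  then have "((\<lambda>n. mon n * H2_inner f (?E n)) has_sum szego1 a z * f q) UNIV"
    unfolding has_sum_def by (rule LIM_zero_cancel)
  then show "((\<lambda>(i, j). H2_inner f (?E (i, j)) * z ^ i * w ^ j) has_sum moebius_z a f (z, w)) UNIV"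
    using zw by (simp add: moebius_z_def on_bidisk_def q_def mon_def case_prod_unfold mult_ac)
qed

text \<open>Both claims are Bessel's inequality for the Blaschke basis. The inequality of norms will turn into
  an equality, because the operator is an involution.\<close>

lemma moebius_z:
  assumes f: "f \<in> H2" and a: "cmod a < 1"
  shows moebius_z_mem [simp]: "moebius_z a f \<in> H2"
    and moebius_z_norm_le: "H2_norm (moebius_z a f) \<le> H2_norm f"
proof -
  define c where "c n = H2_inner f (blaschke_basis a n)" for n
  have "(\<Sum>n\<in>F. (cmod (c n))\<^sup>2) \<le> (H2_norm f)\<^sup>2" if "finite F" for F
    unfolding c_def using f a that by (intro H2_bessel) (auto simp: blaschke_basis_orthonormal)
  note c = l2_boundedI[OF this]
  note mem = H2I[OF _ moebius_z_has_taylor[OF f a, folded c_def] c(1)]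
  show "moebius_z a f \<in> H2" by (rule mem) (simp add: moebius_z_def on_bidisk_def)
  have "taylor_coeff (moebius_z a f) = c" by (rule mem) (simp add: moebius_z_def on_bidisk_def)
  then have "(H2_norm (moebius_z a f))\<^sup>2 \<le> (H2_norm f)\<^sup>2" using c(2) by (simp add: H2_norm_sq)
  then show "H2_norm (moebius_z a f) \<le> H2_norm f" by (rule power2_le_imp_le) simp
qed

lemma moebius_z_involution:
  assumes "f \<in> H2" "cmod a < 1"
  shows "moebius_z a (moebius_z a f) = f"
proof
  fix p
  show "moebius_z a (moebius_z a f) p = f p"
  proof (cases "p \<in> bidisk")
    case True
    then have "cmod (fst p) < 1" and "cmod (snd p) < 1" by (auto simp: bidisk_def)
    then show ?thesis
      using True assms(2) cmod_blaschke_less_one[OF assms(2) \<open>cmod (fst p) < 1\<close>] szego1_blaschke[OF assms(2) \<open>cmod (fst p) < 1\<close>]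
      by (simp add: moebius_z_def on_bidisk_def bidisk_def mult.assoc[symmetric])
  qed (simp add: moebius_z_def on_bidisk_def H2_outside assms(1))
qed

lemma moebius_z_norm:
  assumes "f \<in> H2" "cmod a < 1"
  shows "H2_norm (moebius_z a f) = H2_norm f"
  using moebius_z_norm_le[OF assms] moebius_z_norm_le[OF moebius_z_mem[OF assms] assms(2)]
  by (simp add: moebius_z_involution assms)

lemma H2_polarization:
  assumes "f \<in> H2" "g \<in> H2"
  shows "4 * H2_inner f g = of_real ((H2_norm (\<lambda>p. f p + g p))\<^sup>2) - of_real ((H2_norm (\<lambda>p. f p - g p))\<^sup>2)
    + \<i> * (of_real ((H2_norm (\<lambda>p. f p + \<i> * g p))\<^sup>2) - of_real ((H2_norm (\<lambda>p. f p - \<i> * g p))\<^sup>2))"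
  using assms by (simp add: H2_inner_self[symmetric] del: of_real_power) (simp add: algebra_simps)

lemma H2_inner_moebius_z:
  assumes "f \<in> H2" "g \<in> H2" "cmod a < 1"
  shows "H2_inner (moebius_z a f) (moebius_z a g) = H2_inner f g"
proof -
  have add: "(\<lambda>p. moebius_z a f p + k * moebius_z a g p) = moebius_z a (\<lambda>p. f p + k * g p)"
    and diff: "(\<lambda>p. moebius_z a f p - k * moebius_z a g p) = moebius_z a (\<lambda>p. f p - k * g p)" for k
    by (auto simp: moebius_z_def on_bidisk_def algebra_simps)
  have "4 * H2_inner (moebius_z a f) (moebius_z a g) = 4 * H2_inner f g"
    using assms add[of \<i>] diff[of \<i>] add[of 1] diff[of 1]
    by (simp add: H2_polarization moebius_z_norm)
  then show ?thesis by simp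
qed

abbreviation blaschke_w :: "complex \<Rightarrow> complex \<times> complex \<Rightarrow> complex" where
  "blaschke_w b \<equiv> \<lambda>(z, w). blaschke b w"

text \<open>The automorphism acts on both variables at once, so that the diagonal is preserved and with it
  the submodule of functions that vanish there.\<close>

definition moebius :: "complex \<Rightarrow> (complex \<times> complex \<Rightarrow> complex) \<Rightarrow> complex \<times> complex \<Rightarrow> complex" where
  "moebius a f = on_bidisk (\<lambda>p. szego1 a (fst p) * szego1 a (snd p) * f (blaschke a (fst p), blaschke a (snd p)))"

lemma blaschke_in_bidisk:
  assumes "cmod a < 1" "p \<in> bidisk"
  shows "(blaschke a (fst p), blaschke a (snd p)) \<in> bidisk"
  using assms cmod_blaschke_less_one by (auto simp: bidisk_def)

lemma moebius_eq_moebius_z: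
  assumes "cmod a < 1"
  shows "moebius a f = moebius_z a (swap_vars (moebius_z a (swap_vars f)))"
proof
  fix p
  show "moebius a f p = moebius_z a (swap_vars (moebius_z a (swap_vars f))) p"
  proof (cases "p \<in> bidisk")
    case True
    then have "(blaschke a (fst p), snd p) \<in> bidisk" "(snd p, blaschke a (fst p)) \<in> bidisk"
      using cmod_blaschke_less_one[OF assms, of "fst p"] by (auto simp: bidisk_def)
    then show ?thesis
      using True by (simp add: moebius_def moebius_z_def on_bidisk_def swap_vars_def)
  qed (simp add: moebius_def moebius_z_def on_bidisk_def)
qed

lemma moebius_mem [simp]: "cmod a < 1 \<Longrightarrow> f \<in> H2 \<Longrightarrow> moebius a f \<in> H2"
  by (simp add: moebius_eq_moebius_z)

lemma H2_inner_moebius [simp]: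
  "cmod a < 1 \<Longrightarrow> f \<in> H2 \<Longrightarrow> g \<in> H2 \<Longrightarrow> H2_inner (moebius a f) (moebius a g) = H2_inner f g"
  by (simp add: moebius_eq_moebius_z H2_inner_moebius_z H2_inner_swap_vars)

lemma H2_norm_moebius:
  assumes "cmod a < 1" "f \<in> H2"
  shows "H2_norm (moebius a f) = H2_norm f"
proof -
  have "complex_of_real ((H2_norm (moebius a f))\<^sup>2) = of_real ((H2_norm f)\<^sup>2)"
    using assms by (simp add: H2_inner_self[symmetric] del: of_real_power)
  then have "(H2_norm (moebius a f))\<^sup>2 = (H2_norm f)\<^sup>2" by (simp only: of_real_eq_iff)
  then show ?thesis by (simp add: power2_eq_iff_nonneg)
qed

lemma moebius_involution [simp]:
  assumes "cmod a < 1" "f \<in> H2"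
  shows "moebius a (moebius a f) = f"
proof
  fix p
  show "moebius a (moebius a f) p = f p"
  proof (cases "p \<in> bidisk")
    case True
    then have "cmod (fst p) < 1" and "cmod (snd p) < 1" by (auto simp: bidisk_def)
    note eqs = szego1_blaschke[OF assms(1) this(1)] szego1_blaschke[OF assms(1) this(2)]
    have "moebius a (moebius a f) p =
        (szego1 a (fst p) * szego1 a (blaschke a (fst p))) * (szego1 a (snd p) * szego1 a (blaschke a (snd p)))
        * f (blaschke a (blaschke a (fst p)), blaschke a (blaschke a (snd p)))"
      using True blaschke_in_bidisk[OF assms(1) True] by (simp add: moebius_def on_bidisk_def mult_ac)
    then show ?thesis by (simp add: eqs)
  qed (simp add: moebius_def on_bidisk_def H2_outside assms(2))
qed

lemma moebius_self_adjoint: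
  assumes "cmod a < 1" "f \<in> H2" "g \<in> H2"
  shows "H2_inner (moebius a f) g = H2_inner f (moebius a g)"
  using H2_inner_moebius[OF assms(1,2) moebius_mem[OF assms(1,3)]] assms by simp

text \<open>This reduces multiplication by a Blaschke factor to multiplication by the coordinate.\<close>

lemma moebius_mult_z:
  assumes "cmod a < 1"
  shows "moebius a (mult_op fst f) = mult_op (blaschke_z a) (moebius a f)"
  by (auto simp: moebius_def mult_op_def on_bidisk_def)

lemma mult_blaschke_w_eq: "mult_op (blaschke_w b) f = swap_vars (mult_op (blaschke_z b) (swap_vars f))"
  by (auto simp: mult_op_def swap_vars_def)

lemma mult_blaschke_w_mem [simp]:
  "f \<in> H2 \<Longrightarrow> cmod b < 1 \<Longrightarrow> mult_op (blaschke_w b) f \<in> H2"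
  unfolding mult_blaschke_w_eq by (intro swap_vars_mem mult_blaschke_z_mem)

section \<open>The submodule of functions vanishing on the diagonal\<close>

definition diagonal_submodule :: "(complex \<times> complex \<Rightarrow> complex) set" where
  "diagonal_submodule = {f \<in> H2. \<forall>z. cmod z < 1 \<longrightarrow> f (z, z) = 0}"

text \<open>The normalized sum of all monomials of degree \<open>n\<close>. These functions form an orthonormal basis of
  the orthogonal complement of \<^const>\<open>diagonal_submodule\<close>; restriction to the diagonal identifies
  this complement with the Bergman space of the disk and \<open>diagonal_basis n\<close> with
  \<open>sqrt (n + 1) z ^ n\<close>.\<close>

definition diagonal_basis :: "nat \<Rightarrow> complex \<times> complex \<Rightarrow> complex" where
  "diagonal_basis n = (\<lambda>p. of_real (1 / sqrt (Suc n)) * (\<Sum>i\<le>n. H2_monomial (i, n - i) p))"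

lemma diagonal_basis_mem [simp]: "diagonal_basis n \<in> H2"
  unfolding diagonal_basis_def by (intro H2_sum_mem H2_cmult_mem) simp

lemma homogeneous_sum_mem: "(\<lambda>p. \<Sum>i\<le>n. H2_monomial (i, n - i) p) \<in> H2"
  by (intro H2_sum_mem) simp

lemma H2_inner_diagonal_basis:
  assumes "f \<in> H2"
  shows "H2_inner f (diagonal_basis n) = (\<Sum>i\<le>n. taylor_coeff f (i, n - i)) / of_real (sqrt (Suc n))"
  unfolding diagonal_basis_def
    H2_inner_cmult_right[OF homogeneous_sum_mem assms]
    H2_inner_sum_right[OF H2_monomial_mem assms]
  using assms by (simp add: H2_inner_monomial)

lemma taylor_coeff_diagonal_basis:
  "taylor_coeff (diagonal_basis n) (i, j) = (if i + j = n then of_real (1 / sqrt (Suc n)) else 0)"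
proof -
  have "taylor_coeff (diagonal_basis n) (i, j) =
      of_real (1 / sqrt (Suc n)) * (\<Sum>k\<le>n. if (i, j) = (k, n - k) then 1 else 0)"
    unfolding diagonal_basis_def taylor_coeff_cmult[OF homogeneous_sum_mem]
      taylor_coeff_sum[OF H2_monomial_mem] by (simp add: taylor_coeff_monomial)
  also have "(\<Sum>k\<le>n. if (i, j) = (k, n - k) then 1 else 0) =
      (\<Sum>k\<le>n. if k = i then (if i + j = n then 1 else 0) else (0 :: complex))"
    by (intro sum.cong) auto
  finally show ?thesis by auto
qed

lemma sqrt_Suc_square: "complex_of_real (sqrt (Suc n)) * of_real (sqrt (Suc n)) = of_nat (Suc n)"
  by (simp flip: of_real_mult)

lemma sqrt_Suc_neq_0: "complex_of_real (sqrt (Suc n)) \<noteq> 0"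
  by simp

lemma diagonal_basis_orthonormal:
  "H2_inner (diagonal_basis m) (diagonal_basis n) = (if m = n then 1 else 0)"
proof -
  have "H2_inner (diagonal_basis m) (diagonal_basis n) =
      (\<Sum>i\<le>n. if n = m then of_real (1 / sqrt (Suc m)) else 0) / of_real (sqrt (Suc n))"
    by (auto simp: H2_inner_diagonal_basis taylor_coeff_diagonal_basis intro!: sum.cong)
  also have "\<dots> = (if m = n then of_nat (Suc n) / (of_real (sqrt (Suc n)) * of_real (sqrt (Suc n))) else 0)"
    by (auto simp del: of_nat_Suc)
  also have "\<dots> = (if m = n then 1 else 0)"
    unfolding sqrt_Suc_square by (auto simp del: of_nat_Suc)
  finally show ?thesis .
qed

lemma diagonal_values:
  assumes "f \<in> H2" "cmod z < 1"
  shows "(\<lambda>n. (\<Sum>i\<le>n. taylor_coeff f (i, n - i)) * z ^ n) sums f (z, z)"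
proof -
  have "(z, z) \<in> bidisk" using assms by (simp add: bidisk_def)
  from antidiagonal_sums[OF H2_has_sum[OF assms(1) this]]
  have "(\<lambda>n. \<Sum>i\<le>n. taylor_coeff f (i, n - i) * z ^ i * z ^ (n - i)) sums f (z, z)" by simp
  moreover have "(\<Sum>i\<le>n. taylor_coeff f (i, n - i) * z ^ i * z ^ (n - i)) = (\<Sum>i\<le>n. taylor_coeff f (i, n - i)) * z ^ n" for n
    by (subst sum_distrib_right, rule sum.cong) (auto simp: mult.assoc power_add[symmetric])
  ultimately show ?thesis by simp
qed

text \<open>The sums over the antidiagonals are the coefficients of the restriction to the diagonal.\<close>

lemma diagonal_submodule_iff:
  assumes f: "f \<in> H2"
  shows "f \<in> diagonal_submodule \<longleftrightarrow> (\<forall>n. (\<Sum>i\<le>n. taylor_coeff f (i, n - i)) = 0)"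
proof
  assume "f \<in> diagonal_submodule"
  then have "(\<lambda>n. (\<Sum>i\<le>n. taylor_coeff f (i, n - i)) * z ^ n) sums 0" if "cmod z < 1" for z
    using diagonal_values[OF f that] that by (simp add: diagonal_submodule_def)
  from power_series_coeffs_zero[OF this] show "\<forall>n. (\<Sum>i\<le>n. taylor_coeff f (i, n - i)) = 0" by simp
next
  assume *: "\<forall>n. (\<Sum>i\<le>n. taylor_coeff f (i, n - i)) = 0"
  have "f (z, z) = 0" if "cmod z < 1" for z
    using diagonal_values[OF f that] * by (simp add: sums_iff)
  then show "f \<in> diagonal_submodule" using f by (simp add: diagonal_submodule_def)
qed

lemma diagonal_submodule_mem: "f \<in> diagonal_submodule \<Longrightarrow> f \<in> H2"
  by (simp add: diagonal_submodule_def)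

lemma H2_inner_diagonal_submodule:
  assumes "f \<in> diagonal_submodule"
  shows "H2_inner f (diagonal_basis n) = 0"
  using assms diagonal_submodule_iff[OF diagonal_submodule_mem[OF assms]]
  by (simp add: H2_inner_diagonal_basis diagonal_submodule_mem)

text \<open>The orthogonal projection onto the complement of the submodule. It replaces every coefficient by
  the mean of the coefficients of the same degree. Bessel's inequality for
  \<^const>\<open>diagonal_basis\<close> shows that the result is square-summable.\<close>

definition diagonal_part :: "(complex \<times> complex \<Rightarrow> complex) \<Rightarrow> complex \<times> complex \<Rightarrow> complex" where
  "diagonal_part f =
     H2_of_coeffs (\<lambda>(i, j). H2_inner f (diagonal_basis (i + j)) / of_real (sqrt (Suc (i + j))))"

definition submodule_part :: "(complex \<times> complex \<Rightarrow> complex) \<Rightarrow> complex \<times> complex \<Rightarrow> complex" where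
  "submodule_part f = (\<lambda>p. f p - diagonal_part f p)"

lemma diagonal_part:
  assumes f: "f \<in> H2"
  shows diagonal_part_mem [simp]: "diagonal_part f \<in> H2"
    and taylor_coeff_diagonal_part:
      "taylor_coeff (diagonal_part f) (i, j) = H2_inner f (diagonal_basis (i + j)) / of_real (sqrt (Suc (i + j)))"
proof -
  define c where "c = (\<lambda>(i, j). H2_inner f (diagonal_basis (i + j)) / of_real (sqrt (Suc (i + j))))"
  have "(\<Sum>x\<in>F. (cmod (c x))\<^sup>2) \<le> (H2_norm f)\<^sup>2" if F: "finite F" for F
  proof -
    have "finite ((\<lambda>(i, j). i + j) ` F)" using F by auto
    then obtain K where K: "\<And>x. x \<in> F \<Longrightarrow> fst x + snd x < K"
      unfolding finite_nat_set_iff_bounded by (auto simp: case_prod_unfold)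
    have fin: "finite {(i, j). i + j < K}"
      by (rule finite_subset[of _ "{..K} \<times> {..K}"]) auto
    have "(\<Sum>x\<in>F. (cmod (c x))\<^sup>2) \<le> (\<Sum>x\<in>{(i, j). i + j < K}. (cmod (c x))\<^sup>2)"
      using K fin by (intro sum_mono2) force+
    also have "\<dots> = (\<Sum>n<K. \<Sum>i\<le>n. (cmod (c (i, n - i)))\<^sup>2)"
      using sum.triangle_reindex[of "\<lambda>i j. (cmod (c (i, j)))\<^sup>2" K] by (simp add: case_prod_unfold)
    also have "\<dots> = (\<Sum>n<K. (cmod (H2_inner f (diagonal_basis n)))\<^sup>2)"
    proof (rule sum.cong)
      fix n
      have "(\<Sum>i\<le>n. (cmod (c (i, n - i)))\<^sup>2) = (\<Sum>i\<le>n. (cmod (H2_inner f (diagonal_basis n)))\<^sup>2 / Suc n)"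
        by (rule sum.cong) (auto simp: c_def norm_divide power_divide simp del: of_nat_Suc)
      then show "(\<Sum>i\<le>n. (cmod (c (i, n - i)))\<^sup>2) = (cmod (H2_inner f (diagonal_basis n)))\<^sup>2"
        by simp
    qed simp
    also have "\<dots> \<le> (H2_norm f)\<^sup>2"
      using f by (intro H2_bessel) (auto simp: diagonal_basis_orthonormal)
    finally show ?thesis .
  qed
  then have "l2 c" by (rule l2_boundedI)
  from H2_of_coeffs[OF this] show "diagonal_part f \<in> H2"
    "taylor_coeff (diagonal_part f) (i, j) = H2_inner f (diagonal_basis (i + j)) / of_real (sqrt (Suc (i + j)))"
    by (simp_all add: diagonal_part_def c_def)
qed

lemma H2_inner_diagonal_part_basis [simp]:
  assumes "f \<in> H2"
  shows "H2_inner (diagonal_part f) (diagonal_basis n) = H2_inner f (diagonal_basis n)"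
proof -
  have "H2_inner (diagonal_part f) (diagonal_basis n) =
      H2_inner f (diagonal_basis n) * (of_nat (Suc n) / (of_real (sqrt (Suc n)) * of_real (sqrt (Suc n))))"
    using assms by (simp add: H2_inner_diagonal_basis[of "diagonal_part f"] taylor_coeff_diagonal_part del: of_nat_Suc)
  then show ?thesis unfolding sqrt_Suc_square by (simp del: of_nat_Suc)
qed

lemma submodule_part_mem_H2 [simp]: "f \<in> H2 \<Longrightarrow> submodule_part f \<in> H2"
  by (simp add: submodule_part_def)

lemma submodule_part_mem [simp]:
  assumes "f \<in> H2"
  shows "submodule_part f \<in> diagonal_submodule"
proof -
  have "(\<Sum>i\<le>n. taylor_coeff (submodule_part f) (i, n - i)) = 0" for n
  proof -
    have "H2_inner (submodule_part f) (diagonal_basis n) = 0"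
      using assms by (simp add: submodule_part_def)
    then show ?thesis
      unfolding H2_inner_diagonal_basis[OF submodule_part_mem_H2[OF assms]] using sqrt_Suc_neq_0 by simp
  qed
  then show ?thesis using assms by (simp add: diagonal_submodule_iff)
qed

lemma diagonal_part_orthogonal:
  assumes "f \<in> H2" "g \<in> diagonal_submodule"
  shows "H2_inner (diagonal_part f) g = 0"
proof -
  have g: "g \<in> H2" using assms(2) by (rule diagonal_submodule_mem)
  have "(\<Sum>i\<le>n. taylor_coeff (diagonal_part f) (i, n - i) * cnj (taylor_coeff g (i, n - i))) = 0" for n
  proof -
    have "(\<Sum>i\<le>n. taylor_coeff (diagonal_part f) (i, n - i) * cnj (taylor_coeff g (i, n - i)))
        = (\<Sum>i\<le>n. H2_inner f (diagonal_basis n) / of_real (sqrt (Suc n)) * cnj (taylor_coeff g (i, n - i)))"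
      using assms(1) by (intro sum.cong) (auto simp: taylor_coeff_diagonal_part)
    also have "\<dots> = H2_inner f (diagonal_basis n) / of_real (sqrt (Suc n)) * cnj (\<Sum>i\<le>n. taylor_coeff g (i, n - i))"
      by (simp add: sum_distrib_left)
    also have "\<dots> = 0" using assms(2) diagonal_submodule_iff[OF g] by (simp del: cnj_sum)
    finally show ?thesis .
  qed
  then show ?thesis
    using antidiagonal_sums[OF H2_inner_has_sum[OF diagonal_part_mem[OF assms(1)] g]]
    by (simp add: sums_iff)
qed

lemma diagonal_submodule_diff:
  "f \<in> diagonal_submodule \<Longrightarrow> g \<in> diagonal_submodule \<Longrightarrow> (\<lambda>p. f p - g p) \<in> diagonal_submodule"
  by (auto simp: diagonal_submodule_def)

text \<open>The projection onto the submodule is determined by its inner products. It therefore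
  commutes with every self-adjoint involution that preserves the submodule.\<close>

lemma submodule_part_unique:
  assumes "f \<in> H2" "m \<in> diagonal_submodule" "\<And>g. g \<in> diagonal_submodule \<Longrightarrow> H2_inner f g = H2_inner m g"
  shows "submodule_part f = m"
proof -
  define d where "d = (\<lambda>p. submodule_part f p - m p)"
  have d: "d \<in> diagonal_submodule"
    unfolding d_def using assms by (intro diagonal_submodule_diff) auto
  have [simp]: "d \<in> H2" "m \<in> H2" using d assms(2) diagonal_submodule_mem by auto
  have "H2_inner d d = H2_inner f d - H2_inner (diagonal_part f) d - H2_inner m d"
    unfolding d_def[THEN arg_cong[where f = "\<lambda>x. H2_inner x d"]]
    using assms(1) by (simp add: submodule_part_def)
  also have "\<dots> = 0" using assms(3)[OF d] diagonal_part_orthogonal[OF assms(1) d] by simp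
  finally have "H2_norm d = 0" by (simp add: H2_inner_self)
  then have "d = (\<lambda>_. 0)" by (simp add: H2_norm_eq_0_iff)
  then have "d p = 0" for p by simp
  then show ?thesis by (auto simp: d_def)
qed

lemma H2_inner_submodule_part:
  assumes "f \<in> H2" "g \<in> diagonal_submodule"
  shows "H2_inner (submodule_part f) g = H2_inner f g"
  using assms diagonal_part_orthogonal[OF assms] diagonal_submodule_mem[OF assms(2)]
  by (simp add: submodule_part_def)

lemma submodule_part_id: "f \<in> diagonal_submodule \<Longrightarrow> submodule_part f = f"
  by (intro submodule_part_unique) (auto simp: diagonal_submodule_mem)

lemma submodule_part_add:
  assumes "f \<in> H2" "g \<in> H2"
  shows "submodule_part (\<lambda>p. f p + g p) = (\<lambda>p. submodule_part f p + submodule_part g p)"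
proof (rule submodule_part_unique)
  show "(\<lambda>p. submodule_part f p + submodule_part g p) \<in> diagonal_submodule"
    using submodule_part_mem[OF assms(1)] submodule_part_mem[OF assms(2)]
    by (auto simp: diagonal_submodule_def)
qed (use assms in \<open>auto simp: H2_inner_submodule_part diagonal_submodule_mem\<close>)

definition diagonal_complement :: "(complex \<times> complex \<Rightarrow> complex) set" where
  "diagonal_complement = {f \<in> H2. \<forall>g\<in>diagonal_submodule. H2_inner f g = 0}"

lemma diagonal_complement_mem: "f \<in> diagonal_complement \<Longrightarrow> f \<in> H2"
  by (simp add: diagonal_complement_def)

lemma diagonal_part_complement [simp]: "f \<in> H2 \<Longrightarrow> diagonal_part f \<in> diagonal_complement"
  by (simp add: diagonal_complement_def diagonal_part_orthogonal)

lemma diagonal_basis_complement [simp]: "diagonal_basis n \<in> diagonal_complement"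
  using H2_inner_diagonal_submodule H2_inner_commute[of "diagonal_basis n"]
  by (simp add: diagonal_complement_def)

lemma diagonal_part_id:
  assumes "f \<in> diagonal_complement"
  shows "diagonal_part f = f"
proof -
  have "submodule_part f = (\<lambda>_. 0)"
    using assms by (intro submodule_part_unique) (auto simp: diagonal_complement_def diagonal_submodule_def)
  then have "f p - diagonal_part f p = 0" for p
    unfolding submodule_part_def by metis
  then show ?thesis by auto
qed

lemma H2_inner_diagonal_part:
  assumes "f \<in> H2" "g \<in> diagonal_complement"
  shows "H2_inner (diagonal_part f) g = H2_inner f g"
proof -
  have "H2_inner g (submodule_part f) = 0"
    using assms by (simp add: diagonal_complement_def)
  then have "H2_inner (submodule_part f) g = 0" using H2_inner_commute[of "submodule_part f" g] by simp
  then show ?thesis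
    using assms by (simp add: submodule_part_def diagonal_complement_mem)
qed

lemma moebius_submodule [simp]:
  assumes "cmod a < 1" "f \<in> diagonal_submodule"
  shows "moebius a f \<in> diagonal_submodule"
  using assms moebius_mem[OF assms(1) diagonal_submodule_mem[OF assms(2)]]
  by (auto simp: diagonal_submodule_def) (simp add: moebius_def on_bidisk_def cmod_blaschke_less_one)

lemma moebius_complement [simp]:
  assumes "cmod a < 1" "f \<in> diagonal_complement"
  shows "moebius a f \<in> diagonal_complement"
  using assms by (auto simp: diagonal_complement_def moebius_self_adjoint diagonal_submodule_mem)

lemma submodule_part_moebius:
  assumes "cmod a < 1" "f \<in> H2"
  shows "submodule_part (moebius a f) = moebius a (submodule_part f)"
  using assms by (intro submodule_part_unique)
    (auto simp: moebius_self_adjoint diagonal_submodule_mem H2_inner_submodule_part)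

lemma swap_vars_submodule [simp]: "f \<in> diagonal_submodule \<Longrightarrow> swap_vars f \<in> diagonal_submodule"
  by (auto simp: diagonal_submodule_def) (simp add: swap_vars_def)

lemma swap_vars_self_adjoint:
  assumes "f \<in> H2" "g \<in> H2"
  shows "H2_inner (swap_vars f) g = H2_inner f (swap_vars g)"
  using H2_inner_swap_vars[OF assms(1) swap_vars_mem[OF assms(2)]] by simp

lemma submodule_part_swap_vars:
  assumes "f \<in> H2"
  shows "submodule_part (swap_vars f) = swap_vars (submodule_part f)"
  using assms by (intro submodule_part_unique)
    (auto simp: swap_vars_self_adjoint diagonal_submodule_mem H2_inner_submodule_part)

lemma swap_vars_complement [simp]: "f \<in> diagonal_complement \<Longrightarrow> swap_vars f \<in> diagonal_complement"
  by (auto simp: diagonal_complement_def swap_vars_self_adjoint diagonal_submodule_mem)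

lemma swap_vars_diagonal_basis: "swap_vars (diagonal_basis n) = diagonal_basis n"
  by (rule H2_eqI) (auto simp: taylor_coeff_swap_vars taylor_coeff_diagonal_basis add.commute)

text \<open>The singular values at the origin. For \<open>x = diagonal_basis n\<close>, the projection of \<open>z x\<close> onto the
  complement is \<open>sqrt ((n + 1) / (n + 2))\<close> times the next basis function, which leaves
  \<open>1 - (n + 1) / (n + 2) = 1 / (n + 2)\<close> for the squared norm of the other part. Different \<open>n\<close> give
  orthogonal contributions because they live in different degrees.\<close>

lemma submodule_part_mult_z_sums:
  assumes x: "x \<in> diagonal_complement"
  shows "(\<lambda>n. (cmod (H2_inner x (diagonal_basis n)))\<^sup>2 / real (n + 2)) sums (H2_norm (submodule_part (mult_op fst x)))\<^sup>2"
proof -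
  have [simp]: "x \<in> H2" using x by (rule diagonal_complement_mem)
  \<comment> \<open>On the complement, the coefficients depend only on the degree; \<open>t n\<close> is their value in degree \<open>n\<close>.\<close>
  define t where "t n = H2_inner x (diagonal_basis n) / of_real (sqrt (Suc n))" for n
  have coeff_x: "taylor_coeff x (i, j) = t (i + j)" for i j
    using taylor_coeff_diagonal_part[of x i j] by (simp add: diagonal_part_id[OF x] t_def)
  have coeff_zx: "taylor_coeff (mult_op fst x) (i, n - i) = (if i = 0 then 0 else t (n - 1))" if "i \<le> n" for i n
    using that by (cases i) (auto simp: coeff_x)
  define v where "v = submodule_part (mult_op fst x)"
  have v: "v \<in> H2" by (simp add: v_def)
  have "(\<Sum>i\<le>n. taylor_coeff (mult_op fst x) (i, n - i)) = of_nat n * t (n - 1)" for n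
  proof -
    have "(\<Sum>i\<le>n. taylor_coeff (mult_op fst x) (i, n - i)) = (\<Sum>i\<le>n. if i = 0 then 0 else t (n - 1))"
      by (intro sum.cong) (auto simp: coeff_zx)
    also have "\<dots> = (\<Sum>i\<in>{..n} - {0}. t (n - 1))"
      by (intro sum.mono_neutral_cong_right) auto
    finally show ?thesis by simp
  qed
  then have coeff_part: "taylor_coeff (diagonal_part (mult_op fst x)) (i, n - i) = of_nat n * t (n - 1) / of_nat (Suc n)"
    if "i \<le> n" for i n
    using that by (simp add: taylor_coeff_diagonal_part H2_inner_diagonal_basis divide_divide_eq_left sqrt_Suc_square
      del: of_nat_Suc)
  have coeff_v: "taylor_coeff v (i, Suc n - i) = (if i = 0 then - of_nat (Suc n) else 1) * t n / of_nat (n + 2)"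
    if "i \<le> Suc n" for i n
  proof -
    have ne: "(of_nat (n + 2) :: complex) \<noteq> 0" by (simp only: of_nat_eq_0_iff)
    have "taylor_coeff v (i, Suc n - i) = (if i = 0 then 0 else t n) - of_nat (Suc n) * t n / of_nat (n + 2)"
      unfolding v_def submodule_part_def
      by (subst taylor_coeff_diff) (use that in \<open>simp_all add: coeff_zx coeff_part del: of_nat_Suc\<close>)
    also have "\<dots> = (if i = 0 then - of_nat (Suc n) else 1) * t n / of_nat (n + 2)"
      using ne by (simp add: field_simps)
    finally show ?thesis .
  qed
  define b where "b n = (\<Sum>i\<le>n. (cmod (taylor_coeff v (i, n - i)))\<^sup>2)" for n
  have b_Suc: "b (Suc n) = (cmod (H2_inner x (diagonal_basis n)))\<^sup>2 / real (n + 2)" for n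
  proof -
    define r where "r = (cmod (t n))\<^sup>2 / (real (n + 2))\<^sup>2"
    have r: "(cmod (H2_inner x (diagonal_basis n)))\<^sup>2 = real (Suc n) * (cmod (t n))\<^sup>2"
      by (simp add: t_def norm_divide power_divide del: of_nat_Suc)
    have "b (Suc n) =
        (\<Sum>i\<le>Suc n. (if i = 0 then (real (Suc n))\<^sup>2 else 1) * r)"
      unfolding b_def
      by (intro sum.cong)
        (auto simp: coeff_v r_def norm_mult norm_divide power_mult_distrib power_divide simp del: of_nat_Suc of_nat_add)
    also have "\<dots> = (real (Suc n))\<^sup>2 * r + (\<Sum>i\<le>n. r)"
      by (subst sum.atMost_Suc_shift) simp
    also have "\<dots> = real (Suc n) * real (n + 2) * r"
      by (simp add: power2_eq_square algebra_simps)
    also have "\<dots> = (cmod (H2_inner x (diagonal_basis n)))\<^sup>2 / real (n + 2)"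
    proof -
      have "x * m * (c / m\<^sup>2) = x * c / m" if "m \<noteq> 0" for x m c :: real
        using that by (simp add: power2_eq_square)
      then show ?thesis unfolding r r_def by simp
    qed
    finally show ?thesis .
  qed
  have "b 0 = 0"
    using coeff_zx[of 0 0] coeff_part[of 0 0] by (simp add: b_def v_def submodule_part_def)
  moreover have "b sums (H2_norm v)\<^sup>2"
    using antidiagonal_sums[OF H2_norm_has_sum[OF v]] by (simp add: b_def[abs_def])
  ultimately show ?thesis
    unfolding v_def[symmetric] using sums_Suc_iff[of b "(H2_norm v)\<^sup>2"] by (simp add: b_Suc)
qed

text \<open>Conjugation with the unitary involution \<open>moebius a\<close> transports the singular values from the
  origin to \<open>a\<close>.\<close>

lemma submodule_part_mult_blaschke_z_sums:
  assumes a: "cmod a < 1" and x: "x \<in> diagonal_complement"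
  shows "(\<lambda>n. (cmod (H2_inner (moebius a x) (diagonal_basis n)))\<^sup>2 / real (n + 2))
    sums (H2_norm (submodule_part (mult_op (blaschke_z a) x)))\<^sup>2"
proof -
  have [simp]: "x \<in> H2" using x by (rule diagonal_complement_mem)
  have "mult_op (blaschke_z a) x = moebius a (mult_op fst (moebius a x))"
    using a by (simp add: moebius_mult_z)
  then have "H2_norm (submodule_part (mult_op (blaschke_z a) x)) = H2_norm (submodule_part (mult_op fst (moebius a x)))"
    using a by (simp add: submodule_part_moebius H2_norm_moebius)
  then show ?thesis
    using submodule_part_mult_z_sums[OF moebius_complement[OF a x]] by simp
qed

lemma moebius_swap_vars: "cmod a < 1 \<Longrightarrow> moebius a (swap_vars f) = swap_vars (moebius a f)"
  by (rule ext) (simp add: moebius_def on_bidisk_def swap_vars_def mult_ac)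

lemma H2_norm_swap_vars:
  assumes "f \<in> H2"
  shows "H2_norm (swap_vars f) = H2_norm f"
proof -
  have "complex_of_real ((H2_norm (swap_vars f))\<^sup>2) = of_real ((H2_norm f)\<^sup>2)"
    using assms by (simp add: H2_inner_self[symmetric] H2_inner_swap_vars del: of_real_power)
  then have "(H2_norm (swap_vars f))\<^sup>2 = (H2_norm f)\<^sup>2" by (simp only: of_real_eq_iff)
  then show ?thesis by (simp add: power2_eq_iff_nonneg)
qed

lemma submodule_part_mult_blaschke_w_sums:
  assumes a: "cmod a < 1" and x: "x \<in> diagonal_complement"
  shows "(\<lambda>n. (cmod (H2_inner (moebius a x) (diagonal_basis n)))\<^sup>2 / real (n + 2))
    sums (H2_norm (submodule_part (mult_op (blaschke_w a) x)))\<^sup>2"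
proof -
  have [simp]: "x \<in> H2" using x by (rule diagonal_complement_mem)
  have "H2_inner (moebius a (swap_vars x)) (diagonal_basis n) = H2_inner (moebius a x) (diagonal_basis n)" for n
    using a by (simp add: moebius_swap_vars swap_vars_self_adjoint swap_vars_diagonal_basis)
  moreover have "H2_norm (submodule_part (mult_op (blaschke_w a) x)) =
      H2_norm (submodule_part (mult_op (blaschke_z a) (swap_vars x)))"
    using a by (simp add: mult_blaschke_w_eq submodule_part_swap_vars H2_norm_swap_vars)
  ultimately show ?thesis
    using submodule_part_mult_blaschke_z_sums[OF a swap_vars_complement[OF x]] by simp
qed

section \<open>The submodule generated by the difference of the variables\<close>

lemma poly_functions_monomial: "(\<lambda>p. c * (fst p ^ i * snd p ^ j)) \<in> poly_functions"
proof -
  have "c * (z ^ i * w ^ j) = (\<Sum>k\<le>i + j. \<Sum>l\<le>i + j. (if k = i \<and> l = j then c else 0) * z ^ k * w ^ l)" for z w :: complex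
  proof -
    have "(if k = i \<and> l = j then c else 0) * z ^ k * w ^ l
        = (if l = j then if k = i then c * (z ^ i * w ^ j) else 0 else 0)" for k l
      by auto
    then show ?thesis by simp
  qed
  then show ?thesis
    unfolding poly_functions_def
    by (intro CollectI exI[of _ "i + j"] exI[of _ "\<lambda>k l. if k = i \<and> l = j then c else 0"]) simp
qed

lemma poly_functions_add:
  assumes "q \<in> poly_functions" "r \<in> poly_functions"
  shows "(\<lambda>p. q p + r p) \<in> poly_functions"
proof -
  have extend: "(\<Sum>i\<le>d. \<Sum>j\<le>d. c i j * z ^ i * w ^ j)
      = (\<Sum>i\<le>m. \<Sum>j\<le>m. (if i \<le> d \<and> j \<le> d then c i j else 0) * z ^ i * w ^ j)"
    if "d \<le> m" for d m :: nat and c and z w :: complex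
  proof -
    have "(\<Sum>i\<le>m. \<Sum>j\<le>m. (if i \<le> d \<and> j \<le> d then c i j else 0) * z ^ i * w ^ j)
        = (\<Sum>i\<le>d. \<Sum>j\<le>m. (if i \<le> d \<and> j \<le> d then c i j else 0) * z ^ i * w ^ j)"
      using that by (intro sum.mono_neutral_right) auto
    also have "\<dots> = (\<Sum>i\<le>d. \<Sum>j\<le>d. c i j * z ^ i * w ^ j)"
      using that by (intro sum.cong sum.mono_neutral_cong_right) auto
    finally show ?thesis ..
  qed
  obtain d c where q: "\<And>z w. q (z, w) = (\<Sum>i\<le>d. \<Sum>j\<le>d. c i j * z ^ i * w ^ j)"
    using assms(1) by (auto simp: poly_functions_def)
  obtain e b where r: "\<And>z w. r (z, w) = (\<Sum>i\<le>e. \<Sum>j\<le>e. b i j * z ^ i * w ^ j)"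
    using assms(2) by (auto simp: poly_functions_def)
  define m where "m = max d e"
  define a where "a i j = (if i \<le> d \<and> j \<le> d then c i j else 0) + (if i \<le> e \<and> j \<le> e then b i j else 0)" for i j
  have "q (z, w) + r (z, w) = (\<Sum>i\<le>m. \<Sum>j\<le>m. a i j * z ^ i * w ^ j)" for z w
    unfolding q r a_def by (subst (1 2) extend[of _ m]) (simp_all add: m_def sum.distrib distrib_right)
  then show ?thesis
    unfolding poly_functions_def by blast
qed

lemma poly_functions_sum:
  assumes "\<And>x. x \<in> F \<Longrightarrow> q x \<in> poly_functions"
  shows "(\<lambda>p. \<Sum>x\<in>F. q x p) \<in> poly_functions"
proof -
  have "(\<lambda>_. 0) \<in> poly_functions" using poly_functions_monomial[of 0 0 0] by simp
  with assms show ?thesis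
    by (induction F rule: infinite_finite_induct) (auto intro: poly_functions_add)
qed

abbreviation difference_zw :: "complex \<times> complex \<Rightarrow> complex" where
  "difference_zw \<equiv> on_bidisk (\<lambda>(z, w). z - w)"

lemma poly_mult_difference_in_diagonal_submodule:
  assumes "q \<in> poly_functions"
  shows "(\<lambda>p. q p * difference_zw p) \<in> diagonal_submodule"
proof -
  obtain d c where q: "\<And>z w. q (z, w) = (\<Sum>i\<le>d. \<Sum>j\<le>d. c i j * z ^ i * w ^ j)"
    using assms by (auto simp: poly_functions_def)
  have "(\<lambda>p. q p * difference_zw p) = (\<lambda>p. \<Sum>i\<le>d. \<Sum>j\<le>d. c i j * (H2_monomial (Suc i, j) p - H2_monomial (i, Suc j) p))"
  proof
    fix p :: "complex \<times> complex"
    have "q p * difference_zw p = (\<Sum>i\<le>d. \<Sum>j\<le>d. c i j * fst p ^ i * snd p ^ j * difference_zw p)"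
      using q[of "fst p" "snd p"] by (simp add: sum_distrib_right)
    also have "\<dots> = (\<Sum>i\<le>d. \<Sum>j\<le>d. c i j * (H2_monomial (Suc i, j) p - H2_monomial (i, Suc j) p))"
      by (intro sum.cong refl) (simp add: on_bidisk_def H2_monomial_def case_prod_unfold algebra_simps)
    finally show "q p * difference_zw p = (\<Sum>i\<le>d. \<Sum>j\<le>d. c i j * (H2_monomial (Suc i, j) p - H2_monomial (i, Suc j) p))" .
  qed
  moreover have "(\<lambda>p. \<Sum>i\<le>d. \<Sum>j\<le>d. c i j * (H2_monomial (Suc i, j) p - H2_monomial (i, Suc j) p)) \<in> H2"
    by (intro H2_sum_mem H2_cmult_mem H2_diff_mem) auto
  ultimately have "(\<lambda>p. q p * difference_zw p) \<in> H2" by simp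
  then show ?thesis by (simp add: diagonal_submodule_def on_bidisk_def)
qed

text \<open>Evaluation at a point is continuous in the norm, so vanishing on the diagonal passes to the closure.\<close>

lemma generated_submodule_subset:
  "generated_submodule difference_zw \<subseteq> diagonal_submodule"
proof
  fix f assume f: "f \<in> generated_submodule difference_zw"
  then have f_mem: "f \<in> H2" by (simp add: generated_submodule_def)
  have "f (z, z) = 0" if z: "cmod z < 1" for z
  proof (rule ccontr)
    assume nz: "f (z, z) \<noteq> 0"
    have zz: "(z, z) \<in> bidisk" using z by (simp add: bidisk_def)
    \<comment> \<open>The summand 1 only makes \<open>B\<close> positive.\<close>
    define B where "B = H2_norm (szego (z, z)) + 1"
    have B: "B > 0" unfolding B_def using H2_norm_nonneg[of "szego (z, z)"] by linarith
    have "cmod (f (z, z)) / B > 0" using nz B by simp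
    then obtain q where q: "q \<in> poly_functions" and small: "H2_norm (\<lambda>p. f p - q p * difference_zw p) < cmod (f (z, z)) / B"
      using f unfolding generated_submodule_def by blast
    note qh = poly_mult_difference_in_diagonal_submodule[OF q]
    have diag: "difference_zw (z, z) = 0" by (simp add: on_bidisk_def)
    have "cmod (f (z, z)) \<le> H2_norm (\<lambda>p. f p - q p * difference_zw p) * H2_norm (szego (z, z))"
      using H2_eval_bound[OF H2_diff_mem[OF f_mem diagonal_submodule_mem[OF qh]] zz]
      by (simp only: diag mult_zero_right diff_0_right)
    also have "\<dots> \<le> H2_norm (\<lambda>p. f p - q p * difference_zw p) * B"
      by (intro mult_left_mono) (auto simp: B_def)
    also have "\<dots> < cmod (f (z, z))"
      using small B by (simp add: field_simps)
    finally show False by simp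
  qed
  then show "f \<in> diagonal_submodule" using f_mem by (simp add: diagonal_submodule_def)
qed

text \<open>Subtracting \<open>(\<Sum>i\<le>n. c i) * w ^ n = 0\<close> turns the sum into a combination of the terms
  \<open>w ^ (n - i) * (z ^ i - w ^ i)\<close>.\<close>

lemma homogeneous_divisible:
  fixes z w :: complex
  assumes "(\<Sum>i\<le>n. c i) = 0"
  shows "(\<Sum>i\<le>n. c i * (z ^ i * w ^ (n - i)))
    = (\<Sum>i\<le>n. \<Sum>k<i. c i * (z ^ k * w ^ (n - Suc k))) * (z - w)"
proof -
  have summand: "z ^ i * w ^ (n - i) - w ^ n = (\<Sum>k<i. z ^ k * w ^ (n - Suc k)) * (z - w)" if "i \<le> n" for i
  proof -
    have "w ^ n = w ^ (n - i) * w ^ i" using that by (simp flip: power_add)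
    then have "z ^ i * w ^ (n - i) - w ^ n = w ^ (n - i) * (z ^ i - w ^ i)"
      by (simp add: algebra_simps)
    also have "\<dots> = (\<Sum>k<i. w ^ (n - i) * (w ^ (i - Suc k) * z ^ k)) * (z - w)"
      by (simp add: power_diff_sumr2 sum_distrib_left mult_ac)
    also have "(\<Sum>k<i. w ^ (n - i) * (w ^ (i - Suc k) * z ^ k)) = (\<Sum>k<i. z ^ k * w ^ (n - Suc k))"
    proof (rule sum.cong)
      fix k assume "k \<in> {..<i}"
      then have "w ^ (n - Suc k) = w ^ (n - i) * w ^ (i - Suc k)"
        using that by (simp flip: power_add)
      then show "w ^ (n - i) * (w ^ (i - Suc k) * z ^ k) = z ^ k * w ^ (n - Suc k)" by simp
    qed simp
    finally show ?thesis .
  qed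
  have "(\<Sum>i\<le>n. c i * (z ^ i * w ^ (n - i))) = (\<Sum>i\<le>n. c i * (z ^ i * w ^ (n - i))) - (\<Sum>i\<le>n. c i) * w ^ n"
    using assms by simp
  also have "\<dots> = (\<Sum>i\<le>n. c i * (z ^ i * w ^ (n - i) - w ^ n))"
    by (simp add: sum_distrib_right sum_subtractf right_diff_distrib)
  also have "\<dots> = (\<Sum>i\<le>n. c i * ((\<Sum>k<i. z ^ k * w ^ (n - Suc k)) * (z - w)))"
    by (intro sum.cong) (auto simp: summand)
  finally show ?thesis by (simp add: sum_distrib_left sum_distrib_right mult_ac)
qed

text \<open>If a function vanishes on the diagonal, then so does each of its homogeneous parts. Its truncations
  are therefore polynomial multiples of \<open>z - w\<close>, and they converge to it in norm.\<close>

lemma diagonal_submodule_subset: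
  "diagonal_submodule \<subseteq> generated_submodule difference_zw"
proof
  fix f assume f: "f \<in> diagonal_submodule"
  then have f_mem: "f \<in> H2" by (rule diagonal_submodule_mem)
  define c where "c = taylor_coeff f"
  have "\<exists>q\<in>poly_functions. H2_norm (\<lambda>p. f p - q p * difference_zw p) < \<epsilon>" if \<epsilon>: "\<epsilon> > 0" for \<epsilon>
  proof -
    let ?tri = "\<lambda>K. {(i, j). i + j < K} :: (nat \<times> nat) set"
    have "(\<lambda>K. \<Sum>n\<in>?tri K. (cmod (c n))\<^sup>2) \<longlonglongrightarrow> (H2_norm f)\<^sup>2"
      using filterlim_compose[OF H2_norm_has_sum[OF f_mem, unfolded has_sum_def] filterlim_triangles]
      by (simp add: c_def)
    then have "\<forall>\<^sub>F K in sequentially. (\<Sum>n\<in>?tri K. (cmod (c n))\<^sup>2) > (H2_norm f)\<^sup>2 - \<epsilon>\<^sup>2"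
      by (rule order_tendstoD) (use \<epsilon> in simp)
    then obtain K where K: "(\<Sum>n\<in>?tri K. (cmod (c n))\<^sup>2) > (H2_norm f)\<^sup>2 - \<epsilon>\<^sup>2"
      by (auto simp: eventually_sequentially)
    have fin: "finite (?tri K)"
      by (rule finite_subset[of _ "{..K} \<times> {..K}"]) auto
    define g where "g = (\<lambda>p. \<Sum>n\<in>?tri K. c n * H2_monomial n p)"
    define q where "q = (\<lambda>p. \<Sum>n<K. \<Sum>i\<le>n. \<Sum>k<i. c (i, n - i) * (fst p ^ k * snd p ^ (n - Suc k)))"
    have q: "q \<in> poly_functions"
      unfolding q_def by (intro poly_functions_sum poly_functions_monomial)
    have g_eq: "g p = q p * difference_zw p" for p
    proof (cases "p \<in> bidisk")
      case True
      have "g p = (\<Sum>n<K. \<Sum>i\<le>n. c (i, n - i) * (fst p ^ i * snd p ^ (n - i)))"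
        using sum.triangle_reindex[of "\<lambda>i j. c (i, j) * (fst p ^ i * snd p ^ j)" K] True
        by (simp add: g_def H2_monomial_def on_bidisk_def case_prod_unfold)
      also have "\<dots> = q p * (fst p - snd p)"
        unfolding q_def sum_distrib_right[of _ "{..<K}"]
        using diagonal_submodule_iff[OF f_mem] f
        by (intro sum.cong homogeneous_divisible) (auto simp: c_def)
      finally show ?thesis using True by (simp add: on_bidisk_def case_prod_unfold)
    qed (simp add: g_def H2_monomial_def on_bidisk_def)
    have g: "g \<in> H2" unfolding g_def by (intro H2_sum_mem H2_cmult_mem) simp
    have "taylor_coeff g m = (\<Sum>n\<in>?tri K. if m = n then c n else 0)" for m
      unfolding g_def taylor_coeff_sum[OF H2_cmult_mem[OF H2_monomial_mem]]
        taylor_coeff_cmult[OF H2_monomial_mem]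
      by (auto simp: taylor_coeff_monomial intro!: sum.cong)
    then have coeff_g: "taylor_coeff g m = (if m \<in> ?tri K then c m else 0)" for m
      using fin by simp
    have "((\<lambda>n. (cmod (taylor_coeff (\<lambda>p. f p - g p) n))\<^sup>2) has_sum (H2_norm f)\<^sup>2 - (\<Sum>n\<in>?tri K. (cmod (c n))\<^sup>2)) UNIV"
    proof -
      have "((\<lambda>n. if n \<in> ?tri K then (cmod (c n))\<^sup>2 else 0) has_sum (\<Sum>n\<in>?tri K. (cmod (c n))\<^sup>2)) UNIV"
        by (rule has_sum_cong_neutral[THEN iffD1, OF _ _ _ has_sum_finite[OF fin]]) auto
      note diff = has_sum_add[OF H2_norm_has_sum[OF f_mem] has_sum_uminusI[OF this]]
      have "(cmod (taylor_coeff (\<lambda>p. f p - g p) n))\<^sup>2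
          = (cmod (taylor_coeff f n))\<^sup>2 + - (if n \<in> ?tri K then (cmod (c n))\<^sup>2 else 0)" for n
        using f_mem g by (simp add: coeff_g c_def)
      then show ?thesis using diff by (simp only: diff_conv_add_uminus)
    qed
    from has_sum_unique[OF this H2_norm_has_sum[OF H2_diff_mem[OF f_mem g]]]
    have "(H2_norm (\<lambda>p. f p - g p))\<^sup>2 < \<epsilon>\<^sup>2" using K by linarith
    then have "H2_norm (\<lambda>p. f p - g p) < \<epsilon>" using \<epsilon> by (rule power2_less_imp_less[OF _ less_imp_le])
    then show ?thesis using q by (auto simp: g_eq)
  qed
  then show "f \<in> generated_submodule difference_zw"
    using f_mem by (simp add: generated_submodule_def)
qed

lemma generated_submodule_eq: "generated_submodule difference_zw = diagonal_submodule"
  using generated_submodule_subset diagonal_submodule_subset by blast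

section \<open>The commutator\<close>

text \<open>The adjoint of multiplication by the Blaschke factor in \<open>z\<close> on the whole Hardy space, written
  out by means of the unitary involution.\<close>

definition mult_blaschke_adjoint :: "complex \<Rightarrow> (complex \<times> complex \<Rightarrow> complex) \<Rightarrow> complex \<times> complex \<Rightarrow> complex" where
  "mult_blaschke_adjoint a f = moebius a (backward_shift (moebius a f))"

lemma mult_blaschke_adjoint_mem [simp]: "cmod a < 1 \<Longrightarrow> f \<in> H2 \<Longrightarrow> mult_blaschke_adjoint a f \<in> H2"
  by (simp add: mult_blaschke_adjoint_def)

lemma H2_inner_mult_blaschke_adjoint:
  assumes "cmod a < 1" "f \<in> H2" "g \<in> H2"
  shows "H2_inner (mult_op (blaschke_z a) f) g = H2_inner f (mult_blaschke_adjoint a g)"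
proof -
  have "mult_op (blaschke_z a) f = moebius a (mult_op fst (moebius a f))"
    using assms by (simp add: moebius_mult_z)
  then show ?thesis
    using assms by (simp add: moebius_self_adjoint backward_shift_adjoint mult_blaschke_adjoint_def)
qed

lemma adjoint_on_diagonal_submodule:
  assumes a: "cmod a < 1" and g: "g \<in> H2"
  shows "adjoint_on diagonal_submodule (mult_op (blaschke_z a)) g = submodule_part (mult_blaschke_adjoint a g)"
  unfolding adjoint_on_def
proof (rule the_equality)
  let ?h = "submodule_part (mult_blaschke_adjoint a g)"
  have adj: "H2_inner (mult_op (blaschke_z a) f) g = H2_inner f ?h" if f: "f \<in> diagonal_submodule" for f
  proof -
    have "H2_inner (mult_op (blaschke_z a) f) g = cnj (H2_inner (mult_blaschke_adjoint a g) f)"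
      using H2_inner_mult_blaschke_adjoint[OF a diagonal_submodule_mem[OF f] g]
        H2_inner_commute[of f "mult_blaschke_adjoint a g"] by simp
    also have "\<dots> = H2_inner f ?h"
      using a g f H2_inner_commute[of f ?h] by (simp add: H2_inner_submodule_part)
    finally show ?thesis .
  qed
  then show "?h \<in> diagonal_submodule \<and> (\<forall>f\<in>diagonal_submodule. H2_inner (mult_op (blaschke_z a) f) g = H2_inner f ?h)"
    using a g by simp
  fix h assume h: "h \<in> diagonal_submodule \<and> (\<forall>f\<in>diagonal_submodule. H2_inner (mult_op (blaschke_z a) f) g = H2_inner f h)"
  define d where "d = (\<lambda>p. h p - ?h p)"
  have d: "d \<in> diagonal_submodule"
    unfolding d_def using h a g by (intro diagonal_submodule_diff) auto
  have mem: "d \<in> H2" "h \<in> H2" "?h \<in> H2" using d h a g diagonal_submodule_mem by auto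
  have "H2_inner d d = H2_inner d h - H2_inner d ?h"
    using H2_inner_diff_right[OF mem(2,3,1)] by (simp add: d_def[symmetric])
  also have "\<dots> = 0" using h adj[OF d] d by auto
  finally have "H2_norm d = 0" using mem by (simp add: H2_inner_self)
  then have "d = (\<lambda>_. 0)" using mem by (simp add: H2_norm_eq_0_iff)
  then have "d p = 0" for p by simp
  then show "h = ?h" by (auto simp: d_def)
qed

text \<open>Multiplication by \<open>z\<close> is injective and carries both sides to \<open>\<psi> w * (g (z, w) - g (0, w))\<close>.\<close>

lemma backward_shift_commute:
  assumes mem: "\<And>f. f \<in> H2 \<Longrightarrow> mult_op (\<lambda>(z, w). \<psi> w) f \<in> H2" and g: "g \<in> H2"
  shows "backward_shift (mult_op (\<lambda>(z, w). \<psi> w) g) = mult_op (\<lambda>(z, w). \<psi> w) (backward_shift g)"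
proof -
  let ?T = "mult_op (\<lambda>(z, w). \<psi> w)"
  define d where "d = (\<lambda>p. backward_shift (?T g) p - ?T (backward_shift g) p)"
  have d: "d \<in> H2" unfolding d_def using mem g by simp
  have "mult_op fst d p = 0" for p
  proof (cases "p \<in> bidisk")
    case True
    have "mult_op fst d p = fst p * backward_shift (?T g) p - \<psi> (snd p) * (fst p * backward_shift g p)"
      by (simp add: d_def mult_op_def case_prod_unfold algebra_simps)
    also have "\<dots> = (?T g p - ?T g (0, snd p)) - \<psi> (snd p) * (g p - g (0, snd p))"
      using mult_z_backward_shift[OF mem[OF g] True] mult_z_backward_shift[OF g True] by simp
    also have "\<dots> = 0" by (simp add: mult_op_def case_prod_unfold algebra_simps)
    finally show ?thesis .
  qed (simp add: H2_outside[OF d] mult_op_def)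
  then have "mult_op fst d = (\<lambda>_. 0)" by (rule ext)
  then have "d = (\<lambda>_. 0)" by (rule mult_z_eq_0D[OF d])
  then have "d p = 0" for p by simp
  then show ?thesis by (auto simp: d_def)
qed

lemma mult_blaschke_adjoint_commute:
  assumes a: "cmod a < 1" and b: "cmod b < 1" and f: "f \<in> H2"
  shows "mult_blaschke_adjoint a (mult_op (blaschke_w b) f) = mult_op (blaschke_w b) (mult_blaschke_adjoint a f)"
proof -
  define \<psi> where "\<psi> w = blaschke b (blaschke a w)" for w
  let ?T = "mult_op (\<lambda>(z, w). \<psi> w)"
  have intertwine: "moebius a (mult_op (blaschke_w b) g) = ?T (moebius a g)" for g
    by (auto simp: moebius_def mult_op_def on_bidisk_def \<psi>_def)
  have T: "?T g = moebius a (mult_op (blaschke_w b) (moebius a g))" if "g \<in> H2" for g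
    using a that by (simp add: intertwine)
  have mem: "?T g \<in> H2" if "g \<in> H2" for g
    using a b that by (simp add: T)
  have "mult_blaschke_adjoint a (mult_op (blaschke_w b) f) = moebius a (?T (backward_shift (moebius a f)))"
    using a f by (simp add: mult_blaschke_adjoint_def intertwine backward_shift_commute[OF mem])
  also have "\<dots> = mult_op (blaschke_w b) (mult_blaschke_adjoint a f)"
    using a b f by (simp add: T mult_blaschke_adjoint_def)
  finally show ?thesis .
qed

lemma mult_blaschke_w_submodule [simp]:
  assumes "cmod b < 1" "f \<in> diagonal_submodule"
  shows "mult_op (blaschke_w b) f \<in> diagonal_submodule"
  using assms by (auto simp: diagonal_submodule_def) (simp add: mult_op_def)

definition blaschke_commutator :: "complex \<Rightarrow> complex \<Rightarrow> (complex \<times> complex \<Rightarrow> complex) \<Rightarrow> complex \<times> complex \<Rightarrow> complex" where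
  "blaschke_commutator a b =
     commutator (adjoint_on diagonal_submodule (mult_op (blaschke_z a))) (mult_op (blaschke_w b))"

text \<open>On the whole Hardy space the adjoint commutes with multiplication by a function of \<open>w\<close>. So the
  commutator on the submodule only sees what the adjoint moves out of the submodule, and what
  multiplication then moves back.\<close>

lemma blaschke_commutator_eq:
  assumes a: "cmod a < 1" and b: "cmod b < 1" and f: "f \<in> H2"
  shows "blaschke_commutator a b f =
    submodule_part (mult_op (blaschke_w b) (diagonal_part (mult_blaschke_adjoint a f)))"
proof -
  define g where "g = mult_blaschke_adjoint a f"
  let ?S = "mult_op (blaschke_w b)"
  have g: "g \<in> H2" using a f by (simp add: g_def)
  have "?S g = (\<lambda>p. ?S (diagonal_part g) p + ?S (submodule_part g) p)"
    by (simp add: mult_op_def submodule_part_def algebra_simps)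
  then have "submodule_part (?S g) = (\<lambda>p. submodule_part (?S (diagonal_part g)) p + submodule_part (?S (submodule_part g)) p)"
    using b g by (simp add: submodule_part_add)
  also have "submodule_part (?S (submodule_part g)) = ?S (submodule_part g)"
    using b g by (intro submodule_part_id) simp
  finally show ?thesis
    using a b f g mult_blaschke_adjoint_commute[OF a b f]
    by (simp add: blaschke_commutator_def commutator_def adjoint_on_diagonal_submodule g_def[symmetric])
qed

text \<open>By comparison with the telescoping sum of \<open>1 / ((n + 1) (n + 2))\<close>.\<close>

lemma sum_inverse_squares_le: "(\<Sum>n<K. 1 / (real (n + 2))\<^sup>2) \<le> 1"
proof -
  have "(\<Sum>n<K. 1 / (real (n + 2))\<^sup>2) \<le> 1 - 1 / real (K + 1)"
  proof (induction K)
    case (Suc K)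
    have "1 / (real (K + 2))\<^sup>2 \<le> 1 / (real (K + 1) * real (K + 2))"
      by (intro divide_left_mono) (auto simp: power2_eq_square)
    also have "\<dots> = 1 / real (K + 1) - 1 / real (K + 2)" by (simp add: field_simps)
    finally show ?case using Suc by simp
  qed simp
  then show ?thesis by (smt (verit) divide_nonneg_nonneg of_nat_0_le_iff)
qed

text \<open>The component of the adjoint's value outside of the submodule is expanded in the orthonormal
  family \<open>moebius b (diagonal_basis m)\<close>, on which multiplication by the Blaschke factor in \<open>w\<close> acts
  with known singular values. The coefficients are moved to \<open>e\<close> by passing to the adjoint.\<close>

lemma blaschke_commutator_sums:
  assumes a: "cmod a < 1" and b: "cmod b < 1" and e: "e \<in> diagonal_submodule"
  shows "(\<lambda>m. (cmod (H2_inner (submodule_part (mult_op (blaschke_z a) (moebius b (diagonal_basis m)))) e))\<^sup>2 / real (m + 2))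
    sums (H2_norm (blaschke_commutator a b e))\<^sup>2"
proof -
  have e_mem: "e \<in> H2" using e by (rule diagonal_submodule_mem)
  define y where "y = diagonal_part (mult_blaschke_adjoint a e)"
  have y: "y \<in> diagonal_complement" using a e_mem by (simp add: y_def)
  have "cmod (H2_inner (moebius b y) (diagonal_basis m)) =
      cmod (H2_inner (submodule_part (mult_op (blaschke_z a) (moebius b (diagonal_basis m)))) e)" for m
  proof -
    have "H2_inner (moebius b y) (diagonal_basis m) = H2_inner y (moebius b (diagonal_basis m))"
      using b y by (intro moebius_self_adjoint) (auto simp: diagonal_complement_mem)
    also have "\<dots> = H2_inner (mult_blaschke_adjoint a e) (moebius b (diagonal_basis m))"
      unfolding y_def using a b e_mem by (intro H2_inner_diagonal_part) auto
    also have "\<dots> = cnj (H2_inner (mult_op (blaschke_z a) (moebius b (diagonal_basis m))) e)"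
      using a b e_mem H2_inner_commute[of "mult_blaschke_adjoint a e"]
      by (simp add: H2_inner_mult_blaschke_adjoint)
    finally show ?thesis
      using a b e by (simp add: H2_inner_submodule_part)
  qed
  then show ?thesis
    using submodule_part_mult_blaschke_w_sums[OF b y] a b e_mem
    by (simp add: blaschke_commutator_eq y_def)
qed

text \<open>Summing over \<open>e\<close> by Bessel's inequality and inserting the singular values of the other factor leaves
  \<open>\<Sum>m n. W m n / ((m + 2) (n + 2))\<close>, where \<open>W m n\<close> are the squared entries of the change of basis
  between two orthonormal families. Rows and columns of \<open>W\<close> sum to at most 1, so by
  \<open>2 x y \<le> x\<^sup>2 + y\<^sup>2\<close> the double sum is at most \<open>\<Sum>n. 1 / (n + 2)\<^sup>2\<close>.\<close>

lemma blaschke_commutator_sum_le: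
  assumes a: "cmod a < 1" and b: "cmod b < 1"
    and F: "finite F" "F \<subseteq> diagonal_submodule"
    and on: "\<And>e f. e \<in> F \<Longrightarrow> f \<in> F \<Longrightarrow> H2_inner e f = (if e = f then 1 else 0)"
  shows "(\<Sum>e\<in>F. (H2_norm (blaschke_commutator a b e))\<^sup>2) \<le> 1"
proof -
  define g where "g m = submodule_part (mult_op (blaschke_z a) (moebius b (diagonal_basis m)))" for m
  define W where "W m n = (cmod (H2_inner (moebius a (moebius b (diagonal_basis m))) (diagonal_basis n)))\<^sup>2" for m n
  have g_mem: "g m \<in> H2" for m using a b by (simp add: g_def)
  have g_norm: "(\<lambda>n. W m n / real (n + 2)) sums (H2_norm (g m))\<^sup>2" for m
    unfolding W_def g_def using a b by (intro submodule_part_mult_blaschke_z_sums) auto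
  have norm_1: "(H2_norm (diagonal_basis n))\<^sup>2 = 1" for n
  proof -
    have "complex_of_real ((H2_norm (diagonal_basis n))\<^sup>2) = 1"
      by (simp only: H2_inner_self[symmetric] diagonal_basis_mem diagonal_basis_orthonormal if_True simp_thms)
    then show ?thesis by (simp only: of_real_eq_1_iff)
  qed
  have W_row: "(\<Sum>n<L. W m n) \<le> 1" for m L
  proof -
    have "(\<Sum>n<L. W m n) \<le> (H2_norm (moebius a (moebius b (diagonal_basis m))))\<^sup>2"
      unfolding W_def using a b by (intro H2_bessel) (auto simp: diagonal_basis_orthonormal)
    then show ?thesis using a b by (simp add: H2_norm_moebius norm_1)
  qed
  have W_sym: "W m n = (cmod (H2_inner (moebius b (moebius a (diagonal_basis n))) (diagonal_basis m)))\<^sup>2" for m n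
  proof -
    have "H2_inner (moebius a (moebius b (diagonal_basis m))) (diagonal_basis n)
        = H2_inner (diagonal_basis m) (moebius b (moebius a (diagonal_basis n)))"
      using a b by (simp add: moebius_self_adjoint)
    then show ?thesis
      using H2_inner_commute[of "diagonal_basis m"] by (simp add: W_def)
  qed
  have W_col: "(\<Sum>m<K. W m n) \<le> 1" for n K
  proof -
    have "(\<Sum>m<K. W m n) \<le> (H2_norm (moebius b (moebius a (diagonal_basis n))))\<^sup>2"
      unfolding W_sym using a b by (intro H2_bessel) (auto simp: diagonal_basis_orthonormal)
    then show ?thesis using a b by (simp add: H2_norm_moebius norm_1)
  qed
  have W_nonneg: "W m n \<ge> 0" for m n by (simp add: W_def)
  have double: "(\<Sum>n<L. \<Sum>m<K. W m n / real (n + 2) / real (m + 2)) \<le> 1" for K L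
  proof -
    have "W m n / real (n + 2) / real (m + 2) \<le> (W m n / (real (n + 2))\<^sup>2 + W m n / (real (m + 2))\<^sup>2) / 2" for m n
    proof -
      have "1 / real (n + 2) * (1 / real (m + 2)) \<le> ((1 / real (n + 2))\<^sup>2 + (1 / real (m + 2))\<^sup>2) / 2"
        using sum_squares_bound[of "1 / real (n + 2)" "1 / real (m + 2)"] by simp
      from mult_left_mono[OF this W_nonneg[of m n]] show ?thesis
        by (simp add: power_divide distrib_left)
    qed
    then have "(\<Sum>n<L. \<Sum>m<K. W m n / real (n + 2) / real (m + 2))
        \<le> (\<Sum>n<L. \<Sum>m<K. (W m n / (real (n + 2))\<^sup>2 + W m n / (real (m + 2))\<^sup>2) / 2)"
      by (intro sum_mono)
    also have "\<dots> = ((\<Sum>n<L. (\<Sum>m<K. W m n) / (real (n + 2))\<^sup>2) + (\<Sum>n<L. \<Sum>m<K. W m n / (real (m + 2))\<^sup>2)) / 2"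
      by (simp add: sum.distrib sum_divide_distrib add_divide_distrib)
    also have "(\<Sum>n<L. \<Sum>m<K. W m n / (real (m + 2))\<^sup>2) = (\<Sum>m<K. (\<Sum>n<L. W m n) / (real (m + 2))\<^sup>2)"
      by (subst sum.swap) (simp add: sum_divide_distrib)
    also have "((\<Sum>n<L. (\<Sum>m<K. W m n) / (real (n + 2))\<^sup>2) + (\<Sum>m<K. (\<Sum>n<L. W m n) / (real (m + 2))\<^sup>2)) / 2
        \<le> ((\<Sum>n<L. 1 / (real (n + 2))\<^sup>2) + (\<Sum>m<K. 1 / (real (m + 2))\<^sup>2)) / 2"
      by (intro divide_right_mono add_mono sum_mono W_row W_col) auto
    also have "\<dots> \<le> 1" using sum_inverse_squares_le[of L] sum_inverse_squares_le[of K] by simp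
    finally show ?thesis .
  qed
  have g_weighted: "(\<Sum>m<K. (H2_norm (g m))\<^sup>2 / real (m + 2)) \<le> 1" for K
  proof (rule LIMSEQ_le_const2)
    have "(\<lambda>n. \<Sum>m<K. W m n / real (n + 2) / real (m + 2)) sums (\<Sum>m<K. (H2_norm (g m))\<^sup>2 / real (m + 2))"
      by (intro sums_sum sums_divide g_norm)
    then show "(\<lambda>L. \<Sum>n<L. \<Sum>m<K. W m n / real (n + 2) / real (m + 2)) \<longlonglongrightarrow> (\<Sum>m<K. (H2_norm (g m))\<^sup>2 / real (m + 2))"
      by (simp add: sums_def)
  qed (use double in blast)
  have bessel: "(\<Sum>e\<in>F. (cmod (H2_inner (g m) e))\<^sup>2) \<le> (H2_norm (g m))\<^sup>2" for m
    using F on g_mem by (intro H2_bessel) (auto simp: diagonal_submodule_mem)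
  show ?thesis
  proof (rule LIMSEQ_le_const2)
    have "(\<lambda>m. \<Sum>e\<in>F. (cmod (H2_inner (g m) e))\<^sup>2 / real (m + 2)) sums (\<Sum>e\<in>F. (H2_norm (blaschke_commutator a b e))\<^sup>2)"
      unfolding g_def using a b F by (intro sums_sum blaschke_commutator_sums) auto
    then show "(\<lambda>K. \<Sum>m<K. \<Sum>e\<in>F. (cmod (H2_inner (g m) e))\<^sup>2 / real (m + 2))
        \<longlonglongrightarrow> (\<Sum>e\<in>F. (H2_norm (blaschke_commutator a b e))\<^sup>2)"
      by (simp add: sums_def)
    have "(\<Sum>m<K. \<Sum>e\<in>F. (cmod (H2_inner (g m) e))\<^sup>2 / real (m + 2)) \<le> 1" for K
    proof -
      have "(\<Sum>m<K. \<Sum>e\<in>F. (cmod (H2_inner (g m) e))\<^sup>2 / real (m + 2)) \<le> (\<Sum>m<K. (H2_norm (g m))\<^sup>2 / real (m + 2))"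
        unfolding sum_divide_distrib[symmetric] by (intro sum_mono divide_right_mono bessel) auto
      with g_weighted[of K] show ?thesis by linarith
    qed
    then show "\<exists>N. \<forall>K\<ge>N. (\<Sum>m<K. \<Sum>e\<in>F. (cmod (H2_inner (g m) e))\<^sup>2 / real (m + 2)) \<le> 1" by blast
  qed
qed

section \<open>Orthonormal bases and the Hilbert-Schmidt norm\<close>

definition orthonormal_set :: "(complex \<times> complex \<Rightarrow> complex) set \<Rightarrow> bool" where
  "orthonormal_set B \<longleftrightarrow> (\<forall>e\<in>B. \<forall>f\<in>B. H2_inner e f = (if e = f then 1 else 0))"

text \<open>A maximal orthonormal set; this notion of basis demands only that nothing but zero is
  orthogonal to it.\<close>

lemma orthonormal_basis_exists: "\<exists>B. orthonormal_basis diagonal_submodule B"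
proof -
  define \<A> where "\<A> = {B. B \<subseteq> diagonal_submodule \<and> orthonormal_set B}"
  have "\<exists>B\<in>\<A>. \<forall>X\<in>\<A>. B \<subseteq> X \<longrightarrow> X = B"
  proof (rule subset_Zorn')
    fix C assume C: "subset.chain \<A> C"
    have "H2_inner e f = (if e = f then 1 else 0)" if ef: "e \<in> \<Union>C" "f \<in> \<Union>C" for e f
    proof -
      obtain X Y where XY: "X \<in> C" "Y \<in> C" "e \<in> X" "f \<in> Y" using ef by auto
      then have "X \<subseteq> Y \<or> Y \<subseteq> X" using C by (auto simp: subset.chain_def)
      then obtain Z where "Z \<in> C" "e \<in> Z" "f \<in> Z" using XY by auto
      then show ?thesis using C by (auto simp: subset.chain_def \<A>_def orthonormal_set_def)
    qed
    then show "\<Union>C \<in> \<A>" using C by (auto simp: subset.chain_def \<A>_def orthonormal_set_def)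
  qed
  then obtain B where B: "B \<in> \<A>" and max: "\<And>X. X \<in> \<A> \<Longrightarrow> B \<subseteq> X \<Longrightarrow> X = B" by blast
  have "f = (\<lambda>_. 0)" if f: "f \<in> diagonal_submodule" and orth: "\<forall>e\<in>B. H2_inner f e = 0" for f
  proof (rule ccontr)
    assume nz: "f \<noteq> (\<lambda>_. 0)"
    define g where "g = (\<lambda>p. of_real (1 / H2_norm f) * f p)"
    have f_mem: "f \<in> H2" using f by (rule diagonal_submodule_mem)
    have g: "g \<in> H2" "H2_inner g g = 1"
      using H2_normalize[OF f_mem nz] by (simp_all add: g_def)
    have g_sub: "g \<in> diagonal_submodule" using g(1) f by (simp add: diagonal_submodule_def g_def)
    have ge: "H2_inner g e = 0" if "e \<in> B" for e
    proof -
      have "e \<in> H2" using B that diagonal_submodule_mem by (auto simp: \<A>_def)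
      then show ?thesis unfolding g_def H2_inner_cmult_left[OF f_mem \<open>e \<in> H2\<close>] using orth that by simp
    qed
    then have eg: "H2_inner e g = 0" if "e \<in> B" for e
      using that H2_inner_commute[of e g] by simp
    have "g \<notin> B" using ge g(2) by auto
    moreover have "insert g B \<in> \<A>"
    proof -
      have "H2_inner x y = (if x = y then 1 else 0)" if xy: "x \<in> insert g B" "y \<in> insert g B" for x y
      proof (cases "x \<in> B \<and> y \<in> B")
        case True
        then show ?thesis using B by (simp add: \<A>_def orthonormal_set_def)
      next
        case False
        then consider "x = g" "y = g" | "x = g" "y \<in> B" | "x \<in> B" "y = g" using xy by blast
        then show ?thesis
        proof cases
          case 1 then show ?thesis using g(2) by simp
        next
          case 2 then show ?thesis using ge[OF 2(2)] \<open>g \<notin> B\<close> by metis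
        next
          case 3 then show ?thesis using eg[OF 3(1)] \<open>g \<notin> B\<close> by metis
        qed
      qed
      then show ?thesis using B g_sub unfolding \<A>_def orthonormal_set_def by blast
    qed
    ultimately show False using max[of "insert g B"] by auto
  qed
  then show ?thesis
    using B unfolding orthonormal_basis_def \<A>_def orthonormal_set_def by blast
qed

lemma HS_norm_sq_le:
  assumes ex: "\<exists>B. orthonormal_basis M B"
    and bound: "\<And>F. finite F \<Longrightarrow> F \<subseteq> M \<Longrightarrow> orthonormal_set F \<Longrightarrow> (\<Sum>e\<in>F. (H2_norm (T e))\<^sup>2) \<le> C"
  shows "HS_norm_sq M T \<le> ennreal C"
proof -
  define B where "B = (SOME B. orthonormal_basis M B)"
  have B: "orthonormal_basis M B" unfolding B_def using ex by (rule someI_ex)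
  have "(\<Sum>\<^sub>\<infinity>e\<in>B. ennreal ((H2_norm (T e))\<^sup>2)) \<le> ennreal C"
  proof (rule infsum_le_finite_sums)
    fix F assume F: "finite F" "F \<subseteq> B"
    have "(\<Sum>e\<in>F. ennreal ((H2_norm (T e))\<^sup>2)) = ennreal (\<Sum>e\<in>F. (H2_norm (T e))\<^sup>2)"
      by (rule sum_ennreal) simp
    also have "\<dots> \<le> ennreal C"
    proof (intro ennreal_leI bound F(1))
      show "F \<subseteq> M" "orthonormal_set F"
        using F(2) B unfolding orthonormal_basis_def orthonormal_set_def by blast+
    qed
    finally show "(\<Sum>e\<in>F. ennreal ((H2_norm (T e))\<^sup>2)) \<le> ennreal C" .
  qed (rule nonneg_summable_on_complete, simp)
  then show ?thesis by (simp add: HS_norm_sq_def B_def)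
qed

theorem theorem5p1:
  fixes a b :: complex
  assumes "(a, b) \<in> bidisk"
  shows "Sigma1 (generated_submodule (on_bidisk (\<lambda>(z, w). z - w))) a b \<le> 2"
proof -
  have ab: "cmod a < 1" "cmod b < 1" using assms by (auto simp: bidisk_def)
  have "HS_norm_sq diagonal_submodule (blaschke_commutator a b) \<le> ennreal 1"
    using ab orthonormal_basis_exists
    by (intro HS_norm_sq_le blaschke_commutator_sum_le) (auto simp: orthonormal_set_def)
  also have "\<dots> \<le> 2" by simp
  finally show ?thesis
    by (simp add: Sigma1_def generated_submodule_eq blaschke_commutator_def)
qed

end
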